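(* Let $(U_n)_{n\in\mathbb N}$ be a sequence of subsets of $\mathbb N$ and put $U=U_0$. Suppose that: (i) $(U_n)$ is a weak dyadic tower, i.e. $U_n\equiv_1 2U_{n+1}$ for every $n\in\mathbb N$; (ii) $U$ is not a cylinder; (iii) $U$ has computable reservoirs of both colours; (iv) $(U,(U_n))$ has the base absorption property, i.e. for every $X\leq_1U$ there are $n\in\mathbb N$ and $m\geq1$ such that $U\oplus X\equiv_1 mU_n$. Then every $B\subseteq\mathbb N$ with $B\equiv_{\mathrm{bfo}}U$ is one-one equivalent to $mU_n$ for some $m\geq1$ and $n\in\mathbb N$. Consequently, \[ \left(\{[B]_1:B\equiv_{\mathrm{bfo}}U\},\leq_1\right)\cong(\mathbb D_{>0},\leq) \] as partially ordered sets, where $\mathbb D_{>0}=\{m/2^n:m\geq1,\ n\in\mathbb N\}$ is the set of positive dyadic rationals with the usual order.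
   Context: All sets are subsets of $\mathbb N=\{0,1,2,\ldots\}$. A total computable $f:\mathbb N\to\mathbb N$ is a many-one reduction from $A$ to $B$ if $x\in A\iff f(x)\in B$ for all $x$. It is a one-one reduction if injective, and a bounded finite-one reduction if there is a constant $k\geq1$ with $|f^{-1}(y)|\leq k$ for all $y$. Write $\leq_1$, $\leq_{\mathrm{bfo}}$ for the corresponding reducibilities and $\equiv_1$, $\equiv_{\mathrm{bfo}}$ for the induced equivalences; $[B]_1$ is the $\equiv_1$-class of $B$, and $\leq_1$ induces a partial order on these classes. For each $m\geq1$ fix a computable bijection $\langle\cdot,\cdot\rangle_m:\{0,\ldots,m-1\}\times\mathbb N\to\mathbb N$ with computable inverse, and fix a computable bijection $\langle\cdot,\cdot\rangle:\mathbb N\times\mathbb N\to\mathbb N$. The $m$-fold autojoin is $mA=\{\langle i,x\rangle_m:i<m,\ x\in A\}$; the binary join is $A\oplus B=\{\langle0,x\rangle_2:x\in A\}\cup\{\langle1,x\rangle_2:x\in B\}$. The cylinder over $A$ is $\mathrm{Cyl}(A)=\{\langle x,t\rangle:x\in A,\ t\in\mathbb N\}$; $A$ is a cylinder if $A\equiv_1\mathrm{Cyl}(A)$. $A$ has computable reservoirs of both colours if there are computable infinite sets $R_1\subseteq A$ and $R_0\subseteq\mathbb N\setminus A$. No uniform procedure producing indices of the equivalences in the definition of a weak dyadic tower is assumed. *)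

theory Defs
  imports Complex_Main
begin

section \<open>Computability\<close>

text \<open>
  Programs for the partial recursive functions (Kleene's schemes) and their semantics on argument
  lists.  \<open>Proj i\<close> selects the \<open>i\<close>-th argument (counted from 0); \<open>PrimRec f g\<close> recurses on, and
  \<open>Mu f\<close> searches over, the first argument.  The search of \<open>Mu f\<close> is the usual unbounded one: it
  converges only if \<open>f\<close> converges on all smaller candidates.  Arities are not tracked; a program
  applied to too few arguments diverges.
\<close>

datatype recf =
    Zero
  | Succ
  | Proj nat
  | Comp recf "recf list"
  | PrimRec recf recf
  | Mu recf

primrec reval :: "recf \<Rightarrow> nat list \<Rightarrow> nat option" where
  "reval Zero xs = Some 0"
| "reval Succ xs = (case xs of [] \<Rightarrow> None | x # _ \<Rightarrow> Some (Suc x))"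
| "reval (Proj i) xs = (if i < length xs then Some (xs ! i) else None)"
| "reval (Comp f gs) xs =
     (let ys = map (\<lambda>h. h xs) (map reval gs)
      in if None \<in> set ys then None else reval f (map the ys))"
| "reval (PrimRec f g) xs =
     (case xs of
        [] \<Rightarrow> None
      | n # zs \<Rightarrow>
          rec_nat (reval f zs) (\<lambda>k r. Option.bind r (\<lambda>y. reval g (k # y # zs))) n)"
| "reval (Mu f) xs =
     (if \<exists>n. reval f (n # xs) = Some 0 \<and> (\<forall>k<n. reval f (k # xs) \<noteq> None)
      then Some (LEAST n. reval f (n # xs) = Some 0)
      else None)"

definition computable :: "(nat \<Rightarrow> nat) \<Rightarrow> bool" where
  "computable f \<longleftrightarrow> (\<exists>r. \<forall>x. reval r [x] = Some (f x))"

text \<open>A binary function, of which only the values on \<open>D \<times> \<nat>\<close> are relevant.\<close>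

definition computable2_on :: "nat set \<Rightarrow> (nat \<Rightarrow> nat \<Rightarrow> nat) \<Rightarrow> bool" where
  "computable2_on D f \<longleftrightarrow> (\<exists>r. \<forall>x\<in>D. \<forall>y. reval r [x, y] = Some (f x y))"

definition computable_set :: "nat set \<Rightarrow> bool" where
  "computable_set A \<longleftrightarrow> computable (\<lambda>x. if x \<in> A then 1 else 0)"


section \<open>Reducibilities\<close>

definition many_one_reduction :: "(nat \<Rightarrow> nat) \<Rightarrow> nat set \<Rightarrow> nat set \<Rightarrow> bool" where
  "many_one_reduction f A B \<longleftrightarrow> computable f \<and> (\<forall>x. x \<in> A \<longleftrightarrow> f x \<in> B)"

definition one_red :: "nat set \<Rightarrow> nat set \<Rightarrow> bool" (infix "\<le>\<^sub>1" 50) where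
  "A \<le>\<^sub>1 B \<longleftrightarrow> (\<exists>f. many_one_reduction f A B \<and> inj f)"

definition one_equiv :: "nat set \<Rightarrow> nat set \<Rightarrow> bool" (infix "\<equiv>\<^sub>1" 50) where
  "A \<equiv>\<^sub>1 B \<longleftrightarrow> A \<le>\<^sub>1 B \<and> B \<le>\<^sub>1 A"

definition bounded_finite_one :: "(nat \<Rightarrow> nat) \<Rightarrow> bool" where
  "bounded_finite_one f \<longleftrightarrow> (\<exists>k\<ge>1. \<forall>y. finite (f -` {y}) \<and> card (f -` {y}) \<le> k)"

definition bfo_red :: "nat set \<Rightarrow> nat set \<Rightarrow> bool" (infix "\<le>\<^sub>b\<^sub>f\<^sub>o" 50) where
  "A \<le>\<^sub>b\<^sub>f\<^sub>o B \<longleftrightarrow> (\<exists>f. many_one_reduction f A B \<and> bounded_finite_one f)"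

definition bfo_equiv :: "nat set \<Rightarrow> nat set \<Rightarrow> bool" (infix "\<equiv>\<^sub>b\<^sub>f\<^sub>o" 50) where
  "A \<equiv>\<^sub>b\<^sub>f\<^sub>o B \<longleftrightarrow> A \<le>\<^sub>b\<^sub>f\<^sub>o B \<and> B \<le>\<^sub>b\<^sub>f\<^sub>o A"

definition one_degree :: "nat set \<Rightarrow> nat set set" where
  "one_degree B = {A. A \<equiv>\<^sub>1 B}"

text \<open>The order induced on classes; see \<open>one_degree_le_iff\<close> for independence of representatives.\<close>

definition one_degree_le :: "nat set set \<Rightarrow> nat set set \<Rightarrow> bool" where
  "one_degree_le C D \<longleftrightarrow> (\<exists>A\<in>C. \<exists>B\<in>D. A \<le>\<^sub>1 B)"


section \<open>Pairings, joins and cylinders\<close>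

text \<open>
  The pairings are parameters: \<open>P m i x\<close> stands for $\langle i,x\rangle_m$ and \<open>Q x t\<close> for
  $\langle x,t\rangle$.  A computable inverse of \<open>P m\<close> is given by its two components.  Nothing is
  assumed to be uniform in \<open>m\<close>.
\<close>

definition finite_pairing :: "nat \<Rightarrow> (nat \<Rightarrow> nat \<Rightarrow> nat) \<Rightarrow> bool" where
  "finite_pairing m p \<longleftrightarrow>
     bij_betw (\<lambda>(i, x). p i x) ({..<m} \<times> UNIV) UNIV \<and>
     computable2_on {..<m} p \<and>
     (\<exists>a b. computable a \<and> computable b \<and> (\<forall>i<m. \<forall>x. a (p i x) = i \<and> b (p i x) = x))"

definition pairing :: "(nat \<Rightarrow> nat \<Rightarrow> nat) \<Rightarrow> bool" where
  "pairing q \<longleftrightarrow> bij (\<lambda>(x, t). q x t) \<and> computable2_on UNIV q"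

definition autojoin :: "(nat \<Rightarrow> nat \<Rightarrow> nat \<Rightarrow> nat) \<Rightarrow> nat \<Rightarrow> nat set \<Rightarrow> nat set" where
  "autojoin P m A = {P m i x | i x. i < m \<and> x \<in> A}"

definition join :: "(nat \<Rightarrow> nat \<Rightarrow> nat \<Rightarrow> nat) \<Rightarrow> nat set \<Rightarrow> nat set \<Rightarrow> nat set" where
  "join P A B = {P 2 0 x | x. x \<in> A} \<union> {P 2 1 x | x. x \<in> B}"

definition Cyl :: "(nat \<Rightarrow> nat \<Rightarrow> nat) \<Rightarrow> nat set \<Rightarrow> nat set" where
  "Cyl Q A = {Q x t | x t. x \<in> A}"

definition is_cylinder :: "(nat \<Rightarrow> nat \<Rightarrow> nat) \<Rightarrow> nat set \<Rightarrow> bool" where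
  "is_cylinder Q A \<longleftrightarrow> A \<equiv>\<^sub>1 Cyl Q A"


section \<open>Towers\<close>

definition has_computable_reservoirs :: "nat set \<Rightarrow> bool" where
  "has_computable_reservoirs A \<longleftrightarrow>
     (\<exists>R1 R0. computable_set R1 \<and> infinite R1 \<and> R1 \<subseteq> A \<and>
              computable_set R0 \<and> infinite R0 \<and> R0 \<subseteq> - A)"

definition weak_dyadic_tower ::
  "(nat \<Rightarrow> nat \<Rightarrow> nat \<Rightarrow> nat) \<Rightarrow> (nat \<Rightarrow> nat set) \<Rightarrow> bool" where
  "weak_dyadic_tower P U \<longleftrightarrow> (\<forall>n. U n \<equiv>\<^sub>1 autojoin P 2 (U (Suc n)))"

definition base_absorption ::
  "(nat \<Rightarrow> nat \<Rightarrow> nat \<Rightarrow> nat) \<Rightarrow> nat set \<Rightarrow> (nat \<Rightarrow> nat set) \<Rightarrow> bool" where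
  "base_absorption P V U \<longleftrightarrow>
     (\<forall>X. X \<le>\<^sub>1 V \<longrightarrow> (\<exists>n m. m \<ge> 1 \<and> join P V X \<equiv>\<^sub>1 autojoin P m (U n)))"

definition positive_dyadics :: "rat set" where
  "positive_dyadics = {of_nat m / 2 ^ n | m n :: nat. m \<ge> 1}"

definition order_isomorphic ::
  "'a set \<Rightarrow> ('a \<Rightarrow> 'a \<Rightarrow> bool) \<Rightarrow> 'b set \<Rightarrow> ('b \<Rightarrow> 'b \<Rightarrow> bool) \<Rightarrow> bool" where
  "order_isomorphic S le T le' \<longleftrightarrow>
     (\<exists>\<phi>. bij_betw \<phi> S T \<and> (\<forall>x\<in>S. \<forall>y\<in>S. le x y \<longleftrightarrow> le' (\<phi> x) (\<phi> y)))"


section \<open>The induced order on one-one degrees\<close>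

lemma computable_id: "computable (\<lambda>x. x)"
  unfolding computable_def by (rule exI[of _ "Proj 0"]) simp

lemma computable_comp:
  assumes "computable f" "computable g"
  shows "computable (\<lambda>x. g (f x))"
proof -
  obtain r s where "\<forall>x. reval r [x] = Some (f x)" "\<forall>x. reval s [x] = Some (g x)"
    using assms unfolding computable_def by blast
  then have "\<forall>x. reval (Comp s [r]) [x] = Some (g (f x))"
    by simp
  then show ?thesis
    unfolding computable_def by blast
qed

lemma one_red_refl: "A \<le>\<^sub>1 A"
  unfolding one_red_def many_one_reduction_def
  by (rule exI[of _ "\<lambda>x. x"]) (simp add: computable_id)

lemma one_red_trans:
  assumes "A \<le>\<^sub>1 B" "B \<le>\<^sub>1 C"
  shows "A \<le>\<^sub>1 C"
proof -
  obtain f g where f: "many_one_reduction f A B" "inj f" and g: "many_one_reduction g B C" "inj g"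
    using assms unfolding one_red_def by blast
  have "computable (\<lambda>x. g (f x))"
    using f(1) g(1) unfolding many_one_reduction_def by (intro computable_comp[of f g]) blast+
  moreover have "\<forall>x. x \<in> A \<longleftrightarrow> g (f x) \<in> C"
    using f(1) g(1) unfolding many_one_reduction_def by blast
  moreover have "inj (\<lambda>x. g (f x))"
    using f(2) g(2) unfolding inj_def by blast
  ultimately show ?thesis
    unfolding one_red_def many_one_reduction_def by blast
qed

lemma one_degree_le_iff: "one_degree_le (one_degree A) (one_degree B) \<longleftrightarrow> A \<le>\<^sub>1 B"
proof
  assume "one_degree_le (one_degree A) (one_degree B)"
  then obtain A' B' where "A' \<equiv>\<^sub>1 A" "B' \<equiv>\<^sub>1 B" "A' \<le>\<^sub>1 B'"
    unfolding one_degree_le_def one_degree_def by blast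
  then show "A \<le>\<^sub>1 B"
    unfolding one_equiv_def using one_red_trans[of A A' B'] one_red_trans[of A B' B] by blast
next
  assume "A \<le>\<^sub>1 B"
  then show "one_degree_le (one_degree A) (one_degree B)"
    unfolding one_degree_le_def one_degree_def one_equiv_def using one_red_refl by blast
qed

lemma one_degree_eq_iff: "one_degree A = one_degree B \<longleftrightarrow> A \<equiv>\<^sub>1 B"
proof
  assume "one_degree A = one_degree B"
  moreover have "A \<in> one_degree A"
    unfolding one_degree_def one_equiv_def using one_red_refl by blast
  ultimately show "A \<equiv>\<^sub>1 B"
    unfolding one_degree_def by blast
next
  assume "A \<equiv>\<^sub>1 B"
  then have "X \<equiv>\<^sub>1 A \<longleftrightarrow> X \<equiv>\<^sub>1 B" for X
    unfolding one_equiv_def using one_red_trans[of X A B] one_red_trans[of X B A]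
      one_red_trans[of A B X] one_red_trans[of B A X] by blast
  then show "one_degree A = one_degree B"
    unfolding one_degree_def by blast
qed

end

theory Submission
  imports Defs "HOL-Library.Nat_Bijection"
begin

text \<open>
  Write \<open>mA\<close> for autojoins and \<open>V = U\<^sub>0\<close>.  If \<open>C \<oplus> D \<le>\<^sub>1 C\<close> where \<open>V\<close> is bfo-reducible to \<open>D\<close> and \<open>C\<close> to \<open>V\<close>,
  then iteration yields from each \<open>x\<close> infinitely many numbers of the same colour with respect to \<open>V\<close>,
  so \<open>V\<close> is a cylinder.  Hence \<open>mU\<^sub>n \<le>\<^sub>1 m'U\<^sub>n\<close> only if \<open>m \<le> m'\<close>, and bringing dyadic rationals to a common
  denominator shows that the autojoins of the tower are ordered like the rationals \<open>m/2\<^sup>n\<close>.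

  If \<open>B\<close> is bfo-equivalent to \<open>V\<close>, numbering the elements of the fibres of a reduction \<open>f\<close> of \<open>B\<close> to \<open>V\<close>
  splits \<open>B\<close> into finitely many pieces on which \<open>f\<close> is injective, and the reservoir in the complement of \<open>V\<close>
  makes each piece one-one reducible to \<open>V\<close>.  Absorbing each piece into its own copy of \<open>V\<close> gives
  \<open>kV \<oplus> B \<equiv>\<^sub>1 MU\<^sub>N\<close>, and by the first remark \<open>M > k 2\<^sup>N\<close>, so that \<open>kV \<oplus> B \<equiv>\<^sub>1 kV \<oplus> wU\<^sub>N\<close> with \<open>w \<ge> 1\<close>.  Finally \<open>kV\<close>
  can be cancelled: \<open>C \<oplus> X \<le>\<^sub>1 C \<oplus> Y\<close> implies \<open>X \<le>\<^sub>1 Y\<close> as soon as \<open>C\<close> is bfo-reducible to \<open>Y\<close>.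
\<close>

section \<open>Closure properties of the computable functions\<close>

text \<open>The arity is the length of the argument list, as in \<open>reval\<close>, so that
  composition and recursion are proved for all arities at once; values on lists of other lengths are
  irrelevant.\<close>

definition recursive_at :: "nat \<Rightarrow> (nat list \<Rightarrow> nat) \<Rightarrow> bool" where
  "recursive_at n F \<longleftrightarrow> (\<exists>r. \<forall>xs. length xs = n \<longrightarrow> reval r xs = Some (F xs))"

lemma computable_iff_recursive_at: "computable f \<longleftrightarrow> recursive_at 1 (\<lambda>xs. f (xs ! 0))"
proof -
  have "(\<forall>x. reval r [x] = Some (f x)) \<longleftrightarrow>
      (\<forall>xs. length xs = 1 \<longrightarrow> reval r xs = Some (f (xs ! 0)))" for r
    by (auto simp: length_Suc_conv)
  then show ?thesis
    unfolding computable_def recursive_at_def by simp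
qed

lemma recursive_at_proj: "i < n \<Longrightarrow> recursive_at n (\<lambda>xs. xs ! i)"
  unfolding recursive_at_def by (rule exI[of _ "Proj i"]) simp

lemma recursive_at_comp:
  assumes "recursive_at m F" "length Gs = m" "\<And>G. G \<in> set Gs \<Longrightarrow> recursive_at n G"
  shows "recursive_at n (\<lambda>xs. F (map (\<lambda>G. G xs) Gs))"
proof -
  obtain r where r: "\<And>xs. length xs = m \<Longrightarrow> reval r xs = Some (F xs)"
    using assms(1) unfolding recursive_at_def by blast
  have "\<forall>G\<in>set Gs. \<exists>q. \<forall>xs. length xs = n \<longrightarrow> reval q xs = Some (G xs)"
    using assms(3) unfolding recursive_at_def by blast
  then obtain q where q: "\<And>G xs. G \<in> set Gs \<Longrightarrow> length xs = n \<Longrightarrow> reval (q G) xs = Some (G xs)"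
    by metis
  have "reval (Comp r (map q Gs)) xs = Some (F (map (\<lambda>G. G xs) Gs))" if "length xs = n" for xs
  proof -
    have "map (\<lambda>h. h xs) (map reval (map q Gs)) = map (\<lambda>G. Some (G xs)) Gs"
      using q that by simp
    moreover have "map the (map (\<lambda>G. Some (G xs)) Gs) = map (\<lambda>G. G xs) Gs"
      by simp
    moreover have "None \<notin> set (map (\<lambda>G. Some (G xs)) Gs)"
      by auto
    ultimately show ?thesis
      using r[of "map (\<lambda>G. G xs) Gs"] assms(2) by (simp only: reval.simps Let_def if_False length_map)
  qed
  then show ?thesis
    unfolding recursive_at_def by blast
qed

lemma recursive_at_comp1:
  "computable f \<Longrightarrow> recursive_at n a \<Longrightarrow> recursive_at n (\<lambda>xs. f (a xs))"
  using recursive_at_comp[of 1 "\<lambda>xs. f (xs ! 0)" "[a]" n]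
  by (simp add: computable_iff_recursive_at)

lemma recursive_at_comp2:
  "recursive_at 2 (\<lambda>xs. f (xs ! 0) (xs ! 1)) \<Longrightarrow> recursive_at n a \<Longrightarrow> recursive_at n b \<Longrightarrow>
    recursive_at n (\<lambda>xs. f (a xs) (b xs))"
  using recursive_at_comp[of 2 "\<lambda>xs. f (xs ! 0) (xs ! 1)" "[a, b]" n] by auto

lemma recursive_at_rec:
  assumes "recursive_at n F" "recursive_at (Suc (Suc n)) G"
  shows "recursive_at (Suc n) (\<lambda>xs. rec_nat (F (tl xs)) (\<lambda>k y. G (k # y # tl xs)) (hd xs))"
proof -
  obtain f where f: "\<And>xs. length xs = n \<Longrightarrow> reval f xs = Some (F xs)"
    using assms(1) unfolding recursive_at_def by blast
  obtain g where g: "\<And>xs. length xs = Suc (Suc n) \<Longrightarrow> reval g xs = Some (G xs)"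
    using assms(2) unfolding recursive_at_def by blast
  have "reval (PrimRec f g) xs = Some (rec_nat (F (tl xs)) (\<lambda>k y. G (k # y # tl xs)) (hd xs))"
    if len: "length xs = Suc n" for xs
  proof -
    obtain k zs where xs: "xs = k # zs" "length zs = n"
      using len by (cases xs) auto
    have "rec_nat (reval f zs) (\<lambda>k r. Option.bind r (\<lambda>y. reval g (k # y # zs))) k =
        Some (rec_nat (F zs) (\<lambda>k y. G (k # y # zs)) k)"
      by (induction k) (simp_all add: f g xs(2))
    then show ?thesis
      by (simp add: xs(1))
  qed
  then show ?thesis
    unfolding recursive_at_def by blast
qed

text \<open>Since \<open>G\<close> is total, the condition of \<open>Mu\<close> that all smaller
  candidates converge holds automatically.\<close>

lemma recursive_at_Least:
  assumes "recursive_at (Suc n) G" "\<And>xs. length xs = n \<Longrightarrow> \<exists>k. G (k # xs) = 0"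
  shows "recursive_at n (\<lambda>xs. LEAST k. G (k # xs) = 0)"
proof -
  obtain g where g: "\<And>xs. length xs = Suc n \<Longrightarrow> reval g xs = Some (G xs)"
    using assms(1) unfolding recursive_at_def by blast
  have "reval (Mu g) xs = Some (LEAST k. G (k # xs) = 0)" if "length xs = n" for xs
    using assms(2)[OF that] that by (simp add: g)
  then show ?thesis
    unfolding recursive_at_def by blast
qed

lemma computable_const: "computable (\<lambda>_. c)"
proof (induction c)
  case 0
  show ?case unfolding computable_def by (rule exI[of _ Zero]) simp
next
  case (Suc c)
  then obtain r where "\<forall>x. reval r [x] = Some c"
    unfolding computable_def by blast
  then show ?case
    unfolding computable_def by (intro exI[of _ "Comp Succ [r]"]) simp
qed

lemma computable_Suc_fun: "computable Suc"
  unfolding computable_def by (rule exI[of _ Succ]) simp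

lemma recursive_at_const: "recursive_at n (\<lambda>_. c)"
proof (induction c)
  case 0
  show ?case unfolding recursive_at_def by (rule exI[of _ Zero]) simp
next
  case (Suc c)
  show ?case using recursive_at_comp1[OF computable_Suc_fun Suc] .
qed

lemma recursive_at_Suc: "recursive_at n a \<Longrightarrow> recursive_at n (\<lambda>xs. Suc (a xs))"
  by (rule recursive_at_comp1[OF computable_Suc_fun])

lemma recursive_at_cong:
  "recursive_at n F \<Longrightarrow> (\<And>xs. length xs = n \<Longrightarrow> F xs = G xs) \<Longrightarrow> recursive_at n G"
  unfolding recursive_at_def by auto

lemma length_2_conv: "length xs = 2 \<longleftrightarrow> (\<exists>a b. xs = [a, b])"
  by (auto simp: numeral_2_eq_2 length_Suc_conv)

lemma recursive_at_add: "recursive_at 2 (\<lambda>xs. xs ! 0 + xs ! 1)"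
proof (rule recursive_at_cong)
  show "recursive_at 2 (\<lambda>xs. rec_nat (tl xs ! 0) (\<lambda>k y. Suc ((k # y # tl xs) ! 1)) (hd xs))"
    unfolding numeral_2_eq_2 by (intro recursive_at_rec recursive_at_proj recursive_at_Suc) auto
  have "rec_nat b (\<lambda>k. Suc) a = a + b" for a b :: nat
    by (induction a) auto
  then show "rec_nat (tl xs ! 0) (\<lambda>k y. Suc ((k # y # tl xs) ! 1)) (hd xs) = xs ! 0 + xs ! 1"
    if "length xs = 2" for xs :: "nat list"
    using that by (auto simp: length_2_conv)
qed

lemma computable_pred_fun: "computable (\<lambda>x. x - 1)"
  unfolding computable_iff_recursive_at
proof (rule recursive_at_cong)
  show "recursive_at 1 (\<lambda>xs. rec_nat 0 (\<lambda>k y. (k # y # tl xs) ! 0) (hd xs))"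
    unfolding One_nat_def
    by (intro recursive_at_rec recursive_at_proj recursive_at_const) auto
  have "rec_nat 0 (\<lambda>k r. k) a = a - 1" for a :: nat
    by (induction a) auto
  then show "rec_nat 0 (\<lambda>k y. (k # y # tl xs) ! 0) (hd xs) = xs ! 0 - 1"
    if "length xs = 1" for xs :: "nat list"
    using that by (auto simp: length_Suc_conv)
qed

lemma recursive_at_diff: "recursive_at 2 (\<lambda>xs. xs ! 0 - xs ! 1)"
proof -
  \<comment> \<open>\<open>PrimRec\<close> recurses on the first argument, so the subtrahend comes
    first here; the arguments are swapped afterwards.\<close>
  have "recursive_at 2 (\<lambda>xs. xs ! 1 - xs ! 0)"
  proof (rule recursive_at_cong)
    show "recursive_at 2 (\<lambda>xs. rec_nat (tl xs ! 0) (\<lambda>k y. (k # y # tl xs) ! 1 - 1) (hd xs))"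
      unfolding numeral_2_eq_2
      by (intro recursive_at_rec recursive_at_proj recursive_at_comp1[OF computable_pred_fun]) auto
    have "rec_nat b (\<lambda>k y. y - Suc 0) a = b - a" for a b :: nat
      by (induction a) auto
    then show "rec_nat (tl xs ! 0) (\<lambda>k y. (k # y # tl xs) ! 1 - 1) (hd xs) = xs ! 1 - xs ! 0"
      if "length xs = 2" for xs :: "nat list"
      using that by (auto simp: length_2_conv)
  qed
  from recursive_at_comp2[where f = "\<lambda>a b. b - a", OF this, of 2 "\<lambda>xs. xs ! 1" "\<lambda>xs. xs ! 0"]
  show ?thesis
    by (simp add: recursive_at_proj)
qed

lemma computable_triangle: "computable triangle"
  unfolding computable_iff_recursive_at
proof (rule recursive_at_cong)
  show "recursive_at 1 (\<lambda>xs. rec_nat 0 (\<lambda>k y. (k # y # tl xs) ! 1 + Suc ((k # y # tl xs) ! 0)) (hd xs))"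
    unfolding One_nat_def
    by (intro recursive_at_rec recursive_at_comp2[OF recursive_at_add] recursive_at_proj
        recursive_at_Suc recursive_at_const) auto
  have "rec_nat 0 (\<lambda>k r. r + Suc k) a = triangle a" for a :: nat
    by (induction a) auto
  then show "rec_nat 0 (\<lambda>k y. (k # y # tl xs) ! 1 + Suc ((k # y # tl xs) ! 0)) (hd xs) = triangle (xs ! 0)"
    if "length xs = 1" for xs :: "nat list"
    using that by (auto simp: length_Suc_conv)
qed

text \<open>Cantor's pairing in curried form: an internal coding whose computability is proved
  below, separate from the parameters \<open>P\<close> and \<open>Q\<close>.\<close>

definition pr :: "nat \<Rightarrow> nat \<Rightarrow> nat" where "pr a b = prod_encode (a, b)"
definition p1 :: "nat \<Rightarrow> nat" where "p1 z = fst (prod_decode z)"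
definition p2 :: "nat \<Rightarrow> nat" where "p2 z = snd (prod_decode z)"

lemma p1_pr [simp]: "p1 (pr a b) = a" and p2_pr [simp]: "p2 (pr a b) = b"
  and pr_p1_p2 [simp]: "pr (p1 z) (p2 z) = z"
  by (simp_all add: pr_def p1_def p2_def)

lemma recursive_at_pr: "recursive_at n a \<Longrightarrow> recursive_at n b \<Longrightarrow> recursive_at n (\<lambda>xs. pr (a xs) (b xs))"
  unfolding pr_def prod_encode_def prod.case
  by (intro recursive_at_comp2[OF recursive_at_add] recursive_at_comp1[OF computable_triangle])

lemma triangle_mono: "a \<le> b \<Longrightarrow> triangle a \<le> triangle b"
  unfolding triangle_def by (intro div_le_mono mult_le_mono) auto

lemma eq_triangle_unpair: "z = triangle (p1 z + p2 z) + p1 z"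
proof -
  have "pr (p1 z) (p2 z) = triangle (p1 z + p2 z) + p1 z"
    by (simp only: pr_def prod_encode_def prod.case)
  then show ?thesis
    unfolding pr_p1_p2 .
qed

text \<open>The diagonal containing \<open>z\<close> is the least \<open>s\<close> with
  \<open>z < triangle (Suc s)\<close>; in this form it is found by an unbounded search.\<close>

lemma sum_unpair: "p1 z + p2 z = (LEAST s. Suc z - triangle (Suc s) = 0)"
proof -
  define a b where "a = p1 z" and "b = p2 z"
  have z: "z = triangle (a + b) + a"
    unfolding a_def b_def by (rule eq_triangle_unpair)
  have "(LEAST s. Suc z - triangle (Suc s) = 0) = a + b"
  proof (rule Least_equality)
    show "Suc z - triangle (Suc (a + b)) = 0"
      by (simp add: z)
    fix s assume s: "Suc z - triangle (Suc s) = 0"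
    show "a + b \<le> s"
    proof (rule ccontr)
      assume "\<not> a + b \<le> s"
      then have "triangle (Suc s) \<le> triangle (a + b)"
        by (intro triangle_mono) auto
      then show False
        using s z by linarith
    qed
  qed
  then show ?thesis
    by (simp add: a_def b_def)
qed

lemma computable_unpair_sum: "computable (\<lambda>z. p1 z + p2 z)"
  unfolding sum_unpair computable_iff_recursive_at
proof -
  have "recursive_at 1 (\<lambda>xs. LEAST k. Suc ((k # xs) ! 1) - triangle (Suc ((k # xs) ! 0)) = 0)"
    (is "recursive_at _ (\<lambda>xs. LEAST k. ?G (k # xs) = 0)")
  proof (rule recursive_at_Least)
    show "recursive_at (Suc 1) ?G"
      by (intro recursive_at_comp2[OF recursive_at_diff] recursive_at_comp1[OF computable_triangle]
          recursive_at_Suc recursive_at_proj) auto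
    fix xs :: "nat list"
    have "n \<le> triangle n" for n
      by (induction n) auto
    then have "Suc (xs ! 0) - triangle (Suc (xs ! 0)) = 0"
      using diff_is_0_eq by blast
    then show "\<exists>k. ?G (k # xs) = 0"
      by (intro exI[of _ "xs ! 0"]) simp
  qed
  then show "recursive_at 1 (\<lambda>xs. LEAST s. Suc (xs ! 0) - triangle (Suc s) = 0)"
    by simp
qed

lemma computable_p1_fun: "computable p1"
  and computable_p2_fun: "computable p2"
proof -
  have 1: "z - triangle (p1 z + p2 z) = p1 z" for z
    using eq_triangle_unpair[of z] by linarith
  have "computable (\<lambda>z. triangle (p1 z + p2 z))"
    using computable_comp[OF computable_unpair_sum computable_triangle] .
  then have "computable (\<lambda>z. z - triangle (p1 z + p2 z))"
    unfolding computable_iff_recursive_at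
    by (intro recursive_at_comp2[OF recursive_at_diff] recursive_at_proj) auto
  then show "computable p1"
    unfolding 1 .
  then have "computable (\<lambda>z. (p1 z + p2 z) - p1 z)"
    using computable_unpair_sum unfolding computable_iff_recursive_at
    by (intro recursive_at_comp2[OF recursive_at_diff])
  then show "computable p2"
    by simp
qed

section \<open>Closure rules for unary functions and decidable predicates\<close>

named_theorems computable_intros

definition computable2 :: "(nat \<Rightarrow> nat \<Rightarrow> nat) \<Rightarrow> bool" where
  "computable2 f \<longleftrightarrow> computable (\<lambda>z. f (p1 z) (p2 z))"

lemma computable_app: "computable f \<Longrightarrow> computable a \<Longrightarrow> computable (\<lambda>x. f (a x))"
  by (rule computable_comp[of a f])

lemma computable_pr: "computable a \<Longrightarrow> computable b \<Longrightarrow> computable (\<lambda>x. pr (a x) (b x))"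
  unfolding computable_iff_recursive_at by (rule recursive_at_pr)

lemma computable_app2:
  assumes "computable2 f" "computable a" "computable b"
  shows "computable (\<lambda>x. f (a x) (b x))"
proof -
  have "computable (\<lambda>x. f (p1 (pr (a x) (b x))) (p2 (pr (a x) (b x))))"
    using assms computable_app[of "\<lambda>z. f (p1 z) (p2 z)" "\<lambda>x. pr (a x) (b x)"] computable_pr[of a b]
    unfolding computable2_def by blast
  then show ?thesis
    unfolding p1_pr p2_pr .
qed

lemma computable_add: "computable a \<Longrightarrow> computable b \<Longrightarrow> computable (\<lambda>x. a x + b x)"
  unfolding computable_iff_recursive_at by (rule recursive_at_comp2[OF recursive_at_add])

lemma computable_diff: "computable a \<Longrightarrow> computable b \<Longrightarrow> computable (\<lambda>x. a x - b x)"
  unfolding computable_iff_recursive_at by (rule recursive_at_comp2[OF recursive_at_diff])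

lemmas computable_basic [computable_intros] =
  computable_id computable_const computable_add computable_diff computable_pr
  computable_app[OF computable_Suc_fun]
  computable_app[OF computable_p1_fun] computable_app[OF computable_p2_fun]

text \<open>The step function receives counter, previous value and parameter as one nested pair,
  since \<open>computable\<close> concerns unary functions.\<close>

lemma computable_rec_nat [computable_intros]:
  assumes "computable e" "computable n" "computable (\<lambda>z. g (p1 z) (p1 (p2 z)) (p2 (p2 z)))"
  shows "computable (\<lambda>x. rec_nat (e x) (\<lambda>k y. g k y x) (n x))"
proof -
  let ?h = "\<lambda>k x. rec_nat (e x) (\<lambda>k y. g k y x) k"
  have "recursive_at 2 (\<lambda>xs. ?h (xs ! 0) (xs ! 1))"
  proof (rule recursive_at_cong)
    have "recursive_at (Suc (Suc 1))
        (\<lambda>xs. (\<lambda>z. g (p1 z) (p1 (p2 z)) (p2 (p2 z))) (pr (xs ! 0) (pr (xs ! 1) (xs ! 2))))"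
      by (intro recursive_at_comp1[OF assms(3)] recursive_at_pr recursive_at_proj) auto
    then show "recursive_at 2 (\<lambda>xs. rec_nat (e (tl xs ! 0))
        (\<lambda>k y. (\<lambda>xs. g (xs ! 0) (xs ! 1) (xs ! 2)) (k # y # tl xs)) (hd xs))"
      using assms(1) unfolding computable_iff_recursive_at
      by (subst numeral_2_eq_2, intro recursive_at_rec) (auto simp: numeral_2_eq_2)
  qed (auto simp: length_2_conv)
  then show ?thesis
    using assms(1,2) recursive_at_comp2[of ?h 1 "\<lambda>xs. n (xs ! 0)" "\<lambda>xs. xs ! 0"]
    by (simp add: computable_iff_recursive_at recursive_at_proj)
qed

definition decidable :: "(nat \<Rightarrow> bool) \<Rightarrow> bool" where
  "decidable R \<longleftrightarrow> computable (\<lambda>x. if R x then 1 else 0)"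

lemma decidable_eq_0:
  assumes "computable a" shows "decidable (\<lambda>x. a x = 0)"
proof -
  have "(\<lambda>x. if a x = 0 then 1 else 0) = (\<lambda>x. 1 - a x)"
    by auto
  then show ?thesis
    unfolding decidable_def by (simp add: computable_intros assms)
qed

lemma computable_if [computable_intros]:
  assumes "decidable R" "computable a" "computable b"
  shows "computable (\<lambda>x. if R x then a x else b x)"
proof -
  \<comment> \<open>The conditional is a recursion of length 1 or 0: the step runs once if
    \<open>R x\<close> holds and never otherwise.\<close>
  have "computable (\<lambda>x. rec_nat (b x) (\<lambda>k y. a x) (if R x then 1 else 0))"
    using assms unfolding decidable_def
    by (intro computable_intros) (auto intro!: computable_intros computable_app[of a])
  moreover have "(\<lambda>x. rec_nat (b x) (\<lambda>k y. a x) (if R x then 1 else 0)) = (\<lambda>x. if R x then a x else b x)"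
    by auto
  ultimately show ?thesis
    by simp
qed

lemma if_swap: "(if \<not> b then x else y) = (if b then y else x)"
  by simp

lemma decidable_not [computable_intros]: "decidable R \<Longrightarrow> decidable (\<lambda>x. \<not> R x)"
  using computable_if[of R "\<lambda>_. 0" "\<lambda>_. 1"] unfolding decidable_def
  by (simp add: computable_const if_swap)

lemma decidable_conj [computable_intros]:
  assumes "decidable R" "decidable S" shows "decidable (\<lambda>x. R x \<and> S x)"
proof -
  have "computable (\<lambda>x. if R x then if S x then 1 else 0 else 0)"
    using assms by (intro computable_intros)
  moreover have "(\<lambda>x. if R x \<and> S x then 1 else 0) = (\<lambda>x. if R x then if S x then 1 else 0 else 0 :: nat)"
    by auto
  ultimately show ?thesis
    unfolding decidable_def by simp
qed

lemma decidable_disj [computable_intros]: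
  "decidable R \<Longrightarrow> decidable S \<Longrightarrow> decidable (\<lambda>x. R x \<or> S x)"
  using decidable_not[OF decidable_conj[OF decidable_not decidable_not], of R S] by simp

lemma decidable_le [computable_intros]:
  "computable a \<Longrightarrow> computable b \<Longrightarrow> decidable (\<lambda>x. a x \<le> b x)"
  using decidable_eq_0[OF computable_diff, of a b] by simp

lemma decidable_eq [computable_intros]:
  "computable a \<Longrightarrow> computable b \<Longrightarrow> decidable (\<lambda>x. a x = b x)"
  using decidable_conj[OF decidable_le decidable_le, of a b b a] by (simp add: eq_iff)

lemma decidable_app: "decidable R \<Longrightarrow> computable a \<Longrightarrow> decidable (\<lambda>x. R (a x))"
  unfolding decidable_def by (rule computable_app)

lemma computable_Least [computable_intros]:
  assumes "decidable (\<lambda>z. R (p1 z) (p2 z))" "\<And>x. \<exists>k. R k x"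
  shows "computable (\<lambda>x. LEAST k. R k x)"
proof -
  define G where "G xs = (if R (p1 (pr (xs ! 0) (xs ! 1))) (p2 (pr (xs ! 0) (xs ! 1))) then 0 else 1 :: nat)"
    for xs
  have "computable (\<lambda>z. if R (p1 z) (p2 z) then 0 else 1)"
    using assms(1) by (intro computable_intros)
  from recursive_at_comp1[OF this, of 2 "\<lambda>xs. pr (xs ! 0) (xs ! 1)"]
  have "recursive_at (Suc 1) G"
    unfolding G_def by (simp add: recursive_at_pr recursive_at_proj numeral_2_eq_2)
  then have "recursive_at 1 (\<lambda>xs. LEAST k. G (k # xs) = 0)"
    by (rule recursive_at_Least) (use assms(2) in \<open>auto simp: G_def\<close>)
  moreover have "G (k # xs) = 0 \<longleftrightarrow> R k (xs ! 0)" for k xs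
    by (simp add: G_def)
  ultimately show ?thesis
    by (simp add: computable_iff_recursive_at)
qed


section \<open>Joins and reducibilities\<close>

definition one_reduction :: "(nat \<Rightarrow> nat) \<Rightarrow> nat set \<Rightarrow> nat set \<Rightarrow> bool" where
  "one_reduction f A B \<longleftrightarrow> computable f \<and> inj f \<and> (\<forall>x. x \<in> A \<longleftrightarrow> f x \<in> B)"

lemma one_red_iff: "A \<le>\<^sub>1 B \<longleftrightarrow> (\<exists>f. one_reduction f A B)"
  unfolding one_red_def one_reduction_def many_one_reduction_def by blast

lemma one_reduction_comp:
  assumes f: "one_reduction f A B" and g: "one_reduction g B C"
  shows "one_reduction (\<lambda>x. g (f x)) A C"
proof -
  have "computable (\<lambda>x. g (f x))"
    using f g computable_comp[of f g] unfolding one_reduction_def by blast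
  moreover have "inj (\<lambda>x. g (f x))"
    using f g unfolding one_reduction_def inj_def by blast
  ultimately show ?thesis
    using f g unfolding one_reduction_def by blast
qed

lemma one_equiv_refl: "A \<equiv>\<^sub>1 A"
  by (simp add: one_equiv_def one_red_refl)

lemma one_equiv_sym: "A \<equiv>\<^sub>1 B \<Longrightarrow> B \<equiv>\<^sub>1 A"
  by (simp add: one_equiv_def)

lemma one_equiv_trans: "A \<equiv>\<^sub>1 B \<Longrightarrow> B \<equiv>\<^sub>1 C \<Longrightarrow> A \<equiv>\<^sub>1 C"
  unfolding one_equiv_def using one_red_trans by blast

section \<open>Bounded finite-one reducibility\<close>

lemma bounded_finite_one_comp:
  assumes "bounded_finite_one f" "bounded_finite_one g"
  shows "bounded_finite_one (\<lambda>x. g (f x))"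
proof -
  obtain k l where k: "k \<ge> 1" "\<And>y. finite (f -` {y}) \<and> card (f -` {y}) \<le> k"
    and l: "l \<ge> 1" "\<And>y. finite (g -` {y}) \<and> card (g -` {y}) \<le> l"
    using assms unfolding bounded_finite_one_def by blast
  have "finite ((\<lambda>x. g (f x)) -` {y}) \<and> card ((\<lambda>x. g (f x)) -` {y}) \<le> l * k" for y
  proof -
    have eq: "(\<lambda>x. g (f x)) -` {y} = (\<Union>z\<in>g -` {y}. f -` {z})"
      by auto
    have "card (\<Union>z\<in>g -` {y}. f -` {z}) \<le> (\<Sum>z\<in>g -` {y}. card (f -` {z}))"
      using l by (intro card_UN_le) auto
    also have "\<dots> \<le> (\<Sum>z\<in>g -` {y}. k)"
      using k by (intro sum_mono) auto
    also have "\<dots> \<le> l * k"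
      using l by simp
    finally show ?thesis
      unfolding eq using k l by auto
  qed
  moreover have "l * k \<ge> 1"
    using k l by auto
  ultimately show ?thesis
    unfolding bounded_finite_one_def by blast
qed

lemma bfo_red_trans:
  assumes "A \<le>\<^sub>b\<^sub>f\<^sub>o B" "B \<le>\<^sub>b\<^sub>f\<^sub>o C" shows "A \<le>\<^sub>b\<^sub>f\<^sub>o C"
proof -
  obtain f g where f: "many_one_reduction f A B" "bounded_finite_one f"
    and g: "many_one_reduction g B C" "bounded_finite_one g"
    using assms unfolding bfo_red_def by blast
  have "many_one_reduction (\<lambda>x. g (f x)) A C"
    using f(1) g(1) computable_comp[of f g] unfolding many_one_reduction_def by blast
  then show ?thesis
    using bounded_finite_one_comp[OF f(2) g(2)] unfolding bfo_red_def by blast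
qed

lemma one_red_imp_bfo_red:
  assumes "A \<le>\<^sub>1 B" shows "A \<le>\<^sub>b\<^sub>f\<^sub>o B"
proof -
  obtain f where f: "many_one_reduction f A B" "inj f"
    using assms unfolding one_red_def by blast
  have "finite (f -` {y}) \<and> card (f -` {y}) \<le> 1" for y
    using finite_vimageI[OF _ f(2), of "{y}"] card_vimage_inj_on_le[of f UNIV "{y}"] f(2) by simp
  then have "bounded_finite_one f"
    unfolding bounded_finite_one_def by blast
  then show ?thesis
    using f(1) unfolding bfo_red_def by blast
qed

lemma infinite_image_bounded_finite_one:
  assumes "bounded_finite_one f" "infinite S" shows "infinite (f ` S)"
proof
  assume "finite (f ` S)"
  then have "finite (\<Union>y\<in>f ` S. f -` {y})"
    using assms(1) unfolding bounded_finite_one_def by (intro finite_UN_I) blast+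
  moreover have "S \<subseteq> (\<Union>y\<in>f ` S. f -` {y})"
    by auto
  ultimately show False
    using assms(2) finite_subset by blast
qed

text \<open>Common form of \<open>autojoin\<close> (constant family) and \<open>join\<close> (two
  sets), so that reductions from and into joins are built only once.\<close>

definition gjoin :: "(nat \<Rightarrow> nat \<Rightarrow> nat) \<Rightarrow> nat \<Rightarrow> (nat \<Rightarrow> nat set) \<Rightarrow> nat set" where
  "gjoin p m A = {p i x | i x. i < m \<and> x \<in> A i}"

lemma finite_pairingE:
  assumes "finite_pairing m p"
  obtains a b where "computable a" "computable b"
    "\<forall>i<m. \<forall>x. a (p i x) = i \<and> b (p i x) = x" "\<forall>z. a z < m \<and> p (a z) (b z) = z"
proof -
  obtain a b where ab: "computable a" "computable b" "\<And>i x. i < m \<Longrightarrow> a (p i x) = i \<and> b (p i x) = x"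
    using assms unfolding finite_pairing_def by blast
  have "a z < m \<and> p (a z) (b z) = z" for z
  proof -
    have "z \<in> (\<lambda>(i, x). p i x) ` ({..<m} \<times> UNIV)"
      using assms unfolding finite_pairing_def bij_betw_def by blast
    then show ?thesis
      using ab(3) by auto
  qed
  then show ?thesis
    using that ab by blast
qed

lemma finite_pairing_eq_iff:
  assumes "finite_pairing m p" "i < m" "j < m"
  shows "p i x = p j y \<longleftrightarrow> i = j \<and> x = y"
proof -
  obtain a b where ab: "\<forall>i<m. \<forall>x. a (p i x) = i \<and> b (p i x) = x"
    by (rule finite_pairingE[OF assms(1)]) blast
  have "a (p i x) = i" "a (p j y) = j" "b (p i x) = x" "b (p j y) = y"
    using ab assms(2,3) by auto
  then show ?thesis
    by metis
qed

lemma finite_pairing_surj: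
  assumes "finite_pairing m p"
  obtains i x where "i < m" "z = p i x"
proof -
  obtain a b where "\<forall>z. a z < m \<and> p (a z) (b z) = z"
    by (rule finite_pairingE[OF assms]) blast
  then show ?thesis
    using that[of "a z" "b z"] by simp
qed

lemma computable_finite_pairing:
  assumes "finite_pairing m p" "i < m" shows "computable (p i)"
proof -
  obtain r where r: "\<And>y. reval r [i, y] = Some (p i y)"
    using assms unfolding finite_pairing_def computable2_on_def by blast
  obtain c where c: "\<And>y. reval c [y] = Some i"
    using computable_const[of i] unfolding computable_def by blast
  have "reval (Comp r [c, Proj 0]) [y] = Some (p i y)" for y
    by (simp add: r c)
  then show ?thesis
    unfolding computable_def by blast
qed

lemma mem_gjoin: "finite_pairing m p \<Longrightarrow> i < m \<Longrightarrow> p i x \<in> gjoin p m A \<longleftrightarrow> x \<in> A i"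
  unfolding gjoin_def using finite_pairing_eq_iff by fastforce

text \<open>A cascade of \<open>m\<close> case distinctions merges the programs, which may be
  unrelated to each other.\<close>

lemma computable_finite_cases:
  assumes "\<And>i. i < m \<Longrightarrow> computable (f i)" "computable a" "computable b"
  shows "\<exists>F. computable F \<and> (\<forall>x. a x < m \<longrightarrow> F x = f (a x) (b x))"
  using assms(1)
proof (induction m)
  case 0
  then show ?case using computable_const by auto
next
  case (Suc m)
  then obtain F where F: "computable F" "\<And>x. a x < m \<Longrightarrow> F x = f (a x) (b x)"
    by (auto simp: less_Suc_eq)
  have "computable (\<lambda>x. if a x = m then f m (b x) else F x)"
    using assms(2,3) Suc.prems[of m] F(1) by (intro computable_intros computable_app[of "f m" b]) auto
  moreover have "a x < Suc m \<longrightarrow> (if a x = m then f m (b x) else F x) = f (a x) (b x)" for x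
    using F(2) by auto
  ultimately show ?case
    by blast
qed

text \<open>Component reductions with pairwise disjoint ranges are glued by decoding the block index
  and branching on it. The values of \<open>F\<close> are recorded for later comparisons of
  ranges.\<close>

lemma gjoin_reduction:
  assumes p: "finite_pairing m p"
    and f: "\<And>i. i < m \<Longrightarrow> one_reduction (f i) (A i) C"
    and disj: "\<And>i j x y. i < m \<Longrightarrow> j < m \<Longrightarrow> f i x = f j y \<Longrightarrow> i = j"
  obtains F where "one_reduction F (gjoin p m A) C" "\<And>i x. i < m \<Longrightarrow> F (p i x) = f i x"
proof -
  obtain a b where ab: "computable a" "computable b"
    and inv: "\<forall>i<m. \<forall>x. a (p i x) = i \<and> b (p i x) = x" "\<forall>z. a z < m \<and> p (a z) (b z) = z"
    by (rule finite_pairingE[OF p]) blast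
  have "computable (f i)" if "i < m" for i
    using f[OF that] unfolding one_reduction_def by blast
  from computable_finite_cases[of m f, OF this ab]
  obtain F where F: "computable F" "\<And>z. F z = f (a z) (b z)"
    using inv(2) by auto
  have "inj F"
  proof (rule injI)
    fix z w assume "F z = F w"
    then have "f (a z) (b z) = f (a w) (b w)"
      by (simp add: F(2))
    moreover from this have "a z = a w"
      using disj inv(2) by blast
    moreover have "inj (f (a w))"
      using f inv(2) unfolding one_reduction_def by blast
    ultimately have "b z = b w"
      by (auto dest: injD)
    then show "z = w"
      using \<open>a z = a w\<close> inv(2) by metis
  qed
  moreover have "z \<in> gjoin p m A \<longleftrightarrow> F z \<in> C" for z
    using mem_gjoin[OF p, of "a z" "b z" A] f[of "a z"] inv(2) F(2)[of z]
    unfolding one_reduction_def by simp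
  ultimately have "one_reduction F (gjoin p m A) C"
    using F(1) unfolding one_reduction_def by blast
  then show ?thesis
    using that F(2) inv(1) by auto
qed

lemma gjoin_le:
  assumes "finite_pairing m p" "\<And>i. i < m \<Longrightarrow> one_reduction (f i) (A i) C"
    "\<And>i j x y. i < m \<Longrightarrow> j < m \<Longrightarrow> f i x = f j y \<Longrightarrow> i = j"
  shows "gjoin p m A \<le>\<^sub>1 C"
  by (rule gjoin_reduction[OF assms]) (auto simp: one_red_iff)

lemma one_reduction_gjoin:
  "finite_pairing m p \<Longrightarrow> i < m \<Longrightarrow> one_reduction (p i) (A i) (gjoin p m A)"
  unfolding one_reduction_def
  by (auto simp: mem_gjoin computable_finite_pairing finite_pairing_eq_iff intro: injI)

text \<open>Distinct blocks go to distinct blocks because \<open>s\<close> is injective. The second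
  conclusion keeps track of the target block, from which disjointness of ranges is read off
  later.\<close>

lemma gjoin_map:
  assumes p: "finite_pairing m p" and q: "finite_pairing n q"
    and s: "inj_on s {..<m}" "\<And>i. i < m \<Longrightarrow> s i < n"
    and le: "\<And>i. i < m \<Longrightarrow> A i \<le>\<^sub>1 B (s i)"
  obtains F where "one_reduction F (gjoin p m A) (gjoin q n B)"
    "\<And>i x. i < m \<Longrightarrow> \<exists>y. F (p i x) = q (s i) y"
proof -
  have "\<forall>i\<in>{..<m}. \<exists>f. one_reduction f (A i) (B (s i))"
    using le unfolding one_red_iff by blast
  then obtain f where f: "\<And>i. i < m \<Longrightarrow> one_reduction (f i) (A i) (B (s i))"
    unfolding bchoice_iff by blast
  have "one_reduction (\<lambda>x. q (s i) (f i x)) (A i) (gjoin q n B)" if "i < m" for i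
    using one_reduction_comp[OF f[OF that] one_reduction_gjoin[OF q s(2)[OF that], of B]] .
  moreover have "i = j" if "i < m" "j < m" "q (s i) (f i x) = q (s j) (f j y)" for i j x y
    using that finite_pairing_eq_iff[OF q s(2) s(2), of i j] s(1) by (auto dest: inj_onD)
  ultimately show ?thesis
    by (rule gjoin_reduction[OF p, of "\<lambda>i x. q (s i) (f i x)" A "gjoin q n B"]) (auto intro: that)
qed

lemma gjoin_mono:
  "finite_pairing m p \<Longrightarrow> (\<And>i. i < m \<Longrightarrow> A i \<le>\<^sub>1 B i) \<Longrightarrow> gjoin p m A \<le>\<^sub>1 gjoin p m B"
  by (rule gjoin_map[of m p m p "\<lambda>i. i" A B]) (auto simp: one_red_iff)

lemma gjoin_cong:
  "finite_pairing m p \<Longrightarrow> (\<And>i. i < m \<Longrightarrow> A i \<equiv>\<^sub>1 B i) \<Longrightarrow> gjoin p m A \<equiv>\<^sub>1 gjoin p m B"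
  unfolding one_equiv_def by (simp add: gjoin_mono)

lemma autojoin_eq_gjoin: "autojoin P m A = gjoin (P m) m (\<lambda>_. A)"
  by (simp add: autojoin_def gjoin_def)

lemma join_eq_gjoin: "join P A B = gjoin (P 2) 2 (\<lambda>i. if i = 0 then A else B)"
  unfolding join_def gjoin_def by (auto simp: less_2_cases_iff)

section \<open>Arithmetic of joins and autojoins\<close>

locale pairings =
  fixes P :: "nat \<Rightarrow> nat \<Rightarrow> nat \<Rightarrow> nat"
  assumes fin_pair: "m \<ge> 1 \<Longrightarrow> finite_pairing m (P m)"
begin

lemma fp2: "finite_pairing 2 (P 2)"
  by (simp add: fin_pair)

lemma P2_eq_iff [simp]:
  "P 2 0 x = P 2 0 y \<longleftrightarrow> x = y" "P 2 (Suc 0) x = P 2 (Suc 0) y \<longleftrightarrow> x = y"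
  "P 2 0 x \<noteq> P 2 (Suc 0) y" "P 2 (Suc 0) x \<noteq> P 2 0 y"
  by (simp_all add: finite_pairing_eq_iff[OF fp2])

lemma mem_join [simp]:
  "P 2 0 x \<in> join P A B \<longleftrightarrow> x \<in> A" "P 2 (Suc 0) x \<in> join P A B \<longleftrightarrow> x \<in> B"
  by (simp_all add: join_eq_gjoin mem_gjoin[OF fp2])

lemma one_reduction_inl: "one_reduction (P 2 0) A (join P A B)"
  and one_reduction_inr: "one_reduction (P 2 (Suc 0)) B (join P A B)"
  using one_reduction_gjoin[OF fp2, of 0 "\<lambda>i. if i = 0 then A else B"]
    one_reduction_gjoin[OF fp2, of 1 "\<lambda>i. if i = 0 then A else B"]
  by (simp_all add: join_eq_gjoin)

lemma join_reduction:
  assumes "one_reduction f A C" "one_reduction g B C" "\<And>x y. f x \<noteq> g y"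
  obtains F where "one_reduction F (join P A B) C"
    "\<And>x. F (P 2 0 x) = f x" "\<And>x. F (P 2 (Suc 0) x) = g x"
proof (rule gjoin_reduction[OF fp2, of "\<lambda>i. if i = 0 then f else g" "\<lambda>i. if i = 0 then A else B" C])
  show "one_reduction (if i = 0 then f else g) (if i = 0 then A else B) C" if "i < 2" for i :: nat
    using assms by simp
  show "i = j" if "i < 2" "j < 2" "(if i = 0 then f else g) x = (if j = 0 then f else g) y"
    for i j x y :: nat
    using that assms(3)[of x y] assms(3)[of y x] by (auto split: if_splits simp: less_2_cases_iff)
  fix F assume "one_reduction F (gjoin (P 2) 2 (\<lambda>i. if i = 0 then A else B)) C"
    "\<And>i x. i < 2 \<Longrightarrow> F (P 2 i x) = (if i = 0 then f else g) x"
  then show thesis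
    using that[of F] by (simp add: join_eq_gjoin)
qed

lemma join_le:
  "one_reduction f A C \<Longrightarrow> one_reduction g B C \<Longrightarrow> (\<And>x y. f x \<noteq> g y) \<Longrightarrow> join P A B \<le>\<^sub>1 C"
  by (rule join_reduction[of f A C g B]) (auto simp: one_red_iff)

lemma join_mono: "A \<le>\<^sub>1 A' \<Longrightarrow> B \<le>\<^sub>1 B' \<Longrightarrow> join P A B \<le>\<^sub>1 join P A' B'"
  unfolding join_eq_gjoin by (intro gjoin_mono[OF fp2]) auto

lemma join_cong: "A \<equiv>\<^sub>1 A' \<Longrightarrow> B \<equiv>\<^sub>1 B' \<Longrightarrow> join P A B \<equiv>\<^sub>1 join P A' B'"
  unfolding one_equiv_def by (simp add: join_mono)

text \<open>The index range is cut at \<open>m\<close>: smaller indices form the left summand, the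
  others, shifted down by \<open>m\<close>, the right one.\<close>

lemma gjoin_add:
  assumes "m \<ge> 1" "n \<ge> 1"
  shows "gjoin (P (m + n)) (m + n) A \<equiv>\<^sub>1
    join P (gjoin (P m) m A) (gjoin (P n) n (\<lambda>i. A (m + i)))" (is "?L \<equiv>\<^sub>1 join P ?A ?B")
  unfolding one_equiv_def
proof
  have m: "finite_pairing m (P m)" and n: "finite_pairing n (P n)"
    and mn: "finite_pairing (m + n) (P (m + n))"
    using assms by (auto intro!: fin_pair)
  let ?f = "\<lambda>i x. if i < m then P 2 0 (P m i x) else P 2 (Suc 0) (P n (i - m) x)"
  have "one_reduction (?f i) (A i) (join P ?A ?B)" if "i < m + n" for i
  proof (cases "i < m")
    case True
    then show ?thesis
      using one_reduction_comp[OF one_reduction_gjoin[OF m True] one_reduction_inl] by simp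
  next
    case False
    then have "i - m < n" "m + (i - m) = i"
      using that by auto
    then show ?thesis
      using one_reduction_comp[OF one_reduction_gjoin[OF n \<open>i - m < n\<close>, of "\<lambda>i. A (m + i)"] one_reduction_inr]
        False by simp
  qed
  moreover have "i = j" if "i < m + n" "j < m + n" "?f i x = ?f j y" for i j x y
    using that by (auto split: if_splits simp: finite_pairing_eq_iff[OF m] finite_pairing_eq_iff[OF n])
  ultimately show "?L \<le>\<^sub>1 join P ?A ?B"
    by (rule gjoin_le[OF mn, of ?f])
  obtain F where F: "one_reduction F ?A ?L" "\<And>i x. i < m \<Longrightarrow> \<exists>y. F (P m i x) = P (m + n) i y"
    by (rule gjoin_map[OF m mn, of "\<lambda>i. i" A A]) (auto simp: one_red_refl)
  obtain G where G: "one_reduction G ?B ?L"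
    "\<And>i x. i < n \<Longrightarrow> \<exists>y. G (P n i x) = P (m + n) (m + i) y"
    by (rule gjoin_map[OF n mn, of "\<lambda>i. m + i" "\<lambda>i. A (m + i)" A])
      (auto simp: one_red_refl intro: inj_onI)
  have "F x \<noteq> G y" for x y
  proof -
    obtain i x' where i: "i < m" "x = P m i x'"
      using finite_pairing_surj[OF m] by blast
    obtain j y' where j: "j < n" "y = P n j y'"
      using finite_pairing_surj[OF n] by blast
    obtain u v where "F x = P (m + n) i u" "G y = P (m + n) (m + j) v"
      using F(2)[OF i(1)] G(2)[OF j(1)] i(2) j(2) by metis
    then show ?thesis
      using finite_pairing_eq_iff[OF mn, of i "m + j"] i(1) j(1) by auto
  qed
  then show "join P ?A ?B \<le>\<^sub>1 ?L"
    using join_le[OF F(1) G(1)] by blast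
qed

lemma gjoin_1: "gjoin (P 1) 1 A \<equiv>\<^sub>1 A 0"
proof -
  have p: "finite_pairing 1 (P 1)"
    by (simp add: fin_pair)
  have "one_reduction (\<lambda>x. x) (A i) (A 0)" if "i < 1" for i
    using that by (simp add: one_reduction_def computable_id)
  then have "gjoin (P 1) 1 A \<le>\<^sub>1 A 0"
    by (rule gjoin_le[OF p, of "\<lambda>_ x. x"]) auto
  then show ?thesis
    using one_reduction_gjoin[OF p, of 0 A] unfolding one_equiv_def one_red_iff by auto
qed

lemma autojoin_1: "autojoin P 1 A \<equiv>\<^sub>1 A"
  unfolding autojoin_eq_gjoin using gjoin_1[of "\<lambda>_. A"] .

lemma autojoin_add:
  "m \<ge> 1 \<Longrightarrow> n \<ge> 1 \<Longrightarrow> autojoin P (m + n) A \<equiv>\<^sub>1 join P (autojoin P m A) (autojoin P n A)"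
  unfolding autojoin_eq_gjoin by (rule gjoin_add)

lemma autojoin_cong: "m \<ge> 1 \<Longrightarrow> A \<equiv>\<^sub>1 B \<Longrightarrow> autojoin P m A \<equiv>\<^sub>1 autojoin P m B"
  unfolding autojoin_eq_gjoin by (intro gjoin_cong fin_pair)

lemma autojoin_le:
  assumes "1 \<le> m" "m \<le> n" shows "autojoin P m A \<le>\<^sub>1 autojoin P n A"
  unfolding autojoin_eq_gjoin
  by (rule gjoin_map[OF fin_pair fin_pair, of m n "\<lambda>i. i" "\<lambda>_. A" "\<lambda>_. A"])
    (use assms one_red_refl in \<open>auto simp: one_red_iff\<close>)

text \<open>Block \<open>j\<close> inside block \<open>i\<close> becomes block
  \<open>i * n + j\<close>; quotient and remainder by \<open>n\<close> recover the pair.\<close>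

lemma autojoin_mult:
  assumes "m \<ge> 1" "n \<ge> 1"
  shows "autojoin P m (autojoin P n A) \<equiv>\<^sub>1 autojoin P (m * n) A"
  unfolding one_equiv_def
proof
  have m: "finite_pairing m (P m)" and n: "finite_pairing n (P n)"
    and mn: "finite_pairing (m * n) (P (m * n))"
    using assms by (auto intro!: fin_pair)
  have bound: "i * n + j < m * n" if "i < m" "j < n" for i j
  proof -
    have "i * n + j < Suc i * n"
      using that by simp
    also have "\<dots> \<le> m * n"
      using that by (intro mult_le_mono1) simp
    finally show ?thesis .
  qed
  have "\<exists>F. one_reduction F (autojoin P n A) (autojoin P (m * n) A) \<and>
      (\<forall>j<n. \<forall>x. \<exists>y. F (P n j x) = P (m * n) (i * n + j) y)" if i: "i < m" for i
    by (rule gjoin_map[OF n mn, of "\<lambda>j. i * n + j" "\<lambda>_. A" "\<lambda>_. A"])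
      (use bound[OF i] in \<open>auto simp: one_red_refl autojoin_eq_gjoin intro: inj_onI\<close>)
  then obtain F where F: "\<And>i. i < m \<Longrightarrow> one_reduction (F i) (autojoin P n A) (autojoin P (m * n) A)"
    "\<And>i j x. i < m \<Longrightarrow> j < n \<Longrightarrow> \<exists>y. F i (P n j x) = P (m * n) (i * n + j) y"
    by metis
  have "i = i'" if i: "i < m" "i' < m" "F i x = F i' y" for i i' x y
  proof -
    obtain j x' where j: "j < n" "x = P n j x'"
      using finite_pairing_surj[OF n] by blast
    obtain j' y' where j': "j' < n" "y = P n j' y'"
      using finite_pairing_surj[OF n] by blast
    obtain u v where "F i x = P (m * n) (i * n + j) u" "F i' y = P (m * n) (i' * n + j') v"
      using F(2)[OF i(1) j(1)] F(2)[OF i(2) j'(1)] j(2) j'(2) by metis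
    then have "i * n + j = i' * n + j'"
      using i(3) finite_pairing_eq_iff[OF mn bound[OF i(1) j(1)] bound[OF i(2) j'(1)]] by metis
    then have "(i * n + j) div n = (i' * n + j') div n"
      by simp
    then show ?thesis
      using j(1) j'(1) by simp
  qed
  then show "autojoin P m (autojoin P n A) \<le>\<^sub>1 autojoin P (m * n) A"
    using F(1) by (subst autojoin_eq_gjoin, intro gjoin_le[OF m, of F])
  let ?f = "\<lambda>k x. P m (k div n) (P n (k mod n) x)"
  have k: "k div n < m" "k mod n < n" if "k < m * n" for k
    using that assms by (auto simp: less_mult_imp_div_less)
  have "one_reduction (?f k) A (autojoin P m (autojoin P n A))" if "k < m * n" for k
    unfolding autojoin_eq_gjoin
    using one_reduction_comp[OF one_reduction_gjoin[OF n k(2)[OF that]] one_reduction_gjoin[OF m k(1)[OF that]]] .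
  moreover have "k = l" if "k < m * n" "l < m * n" "?f k x = ?f l y" for k l x y
  proof -
    have "k div n = l div n" "k mod n = l mod n"
      using that(3) finite_pairing_eq_iff[OF m] finite_pairing_eq_iff[OF n] k[OF that(1)] k[OF that(2)]
      by metis+
    then show ?thesis
      by (metis div_mult_mod_eq)
  qed
  ultimately show "autojoin P (m * n) A \<le>\<^sub>1 autojoin P m (autojoin P n A)"
    by (subst autojoin_eq_gjoin) (rule gjoin_le[OF mn, of ?f])
qed

text \<open>Forgetting the block index preserves membership and is at most
  \<open>m\<close>-to-one.\<close>

lemma autojoin_bfo_red:
  assumes "m \<ge> 1" shows "autojoin P m A \<le>\<^sub>b\<^sub>f\<^sub>o A"
proof -
  have m: "finite_pairing m (P m)"
    using assms by (rule fin_pair)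
  obtain a b where ab: "computable b" and "\<forall>z. a z < m \<and> P m (a z) (b z) = z"
    by (rule finite_pairingE[OF m]) blast
  then have surj: "\<And>z. a z < m" "\<And>z. P m (a z) (b z) = z"
    by auto
  have "z \<in> autojoin P m A \<longleftrightarrow> b z \<in> A" for z
    using mem_gjoin[OF m surj(1), of z "b z" "\<lambda>_. A"] surj(2)[of z] unfolding autojoin_eq_gjoin by simp
  moreover have "finite (b -` {y}) \<and> card (b -` {y}) \<le> m" for y
  proof -
    have "b -` {y} \<subseteq> (\<lambda>i. P m i y) ` {..<m}"
    proof
      fix z assume "z \<in> b -` {y}"
      then have "z = P m (a z) y"
        using surj(2)[of z] by simp
      then show "z \<in> (\<lambda>i. P m i y) ` {..<m}"
        using surj(1)[of z] by blast
    qed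
    then show ?thesis
      using card_mono[of "(\<lambda>i. P m i y) ` {..<m}" "b -` {y}"] card_image_le[of "{..<m}" "\<lambda>i. P m i y"]
      using finite_subset by fastforce
  qed
  ultimately show ?thesis
    using assms ab unfolding bfo_red_def many_one_reduction_def bounded_finite_one_def by blast
qed

end

section \<open>Greedy reductions and cylinders\<close>

text \<open>For each \<open>n\<close>, take the first enumerated value \<open>H n t\<close> that
  exceeds all earlier choices. Infinitude makes the search end, and strict growth gives injectivity
  without storing the history.\<close>

lemma increasing_choice:
  assumes H: "computable2 H" and inf: "\<And>n. infinite (range (H n))"
  obtains G where "computable G" "strict_mono G" "\<And>n. \<exists>t. G n = H n t"
proof -
  define v where "v n s = H n (LEAST t. s \<le> H n t)" for n s
  \<comment> \<open>\<open>S n\<close> is one more than the value chosen for \<open>n - 1\<close>,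
    and 0 at the start.\<close>
  define S where "S = rec_nat 0 (\<lambda>n s. Suc (v n s))"
  have ex: "\<exists>t. s \<le> H n t" for n s
    using inf[of n] unfolding finite_nat_set_iff_bounded_le by (auto simp: not_le intro: less_imp_le)
  have "computable2 v"
    unfolding computable2_def v_def
    by (intro computable_app2[OF H] computable_intros ex)
  then have "computable (\<lambda>n. rec_nat 0 (\<lambda>n s. Suc (v n s)) n)"
    by (intro computable_intros computable_app2[of v])
  then have "computable S"
    by (simp add: S_def)
  then have "computable (\<lambda>n. v n (S n))"
    using \<open>computable2 v\<close> by (intro computable_app2[of v] computable_id)
  moreover have "strict_mono (\<lambda>n. v n (S n))"
  proof (rule strict_mono_Suc_iff[THEN iffD2], rule allI)
    fix n
    have "S (Suc n) \<le> v (Suc n) (S (Suc n))"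
      unfolding v_def using ex by (rule LeastI_ex)
    then show "v n (S n) < v (Suc n) (S (Suc n))"
      by (simp add: S_def)
  qed
  moreover have "\<exists>t. v n (S n) = H n t" for n
    unfolding v_def by blast
  ultimately show ?thesis
    using that by blast
qed

lemma computable2_pairing:
  assumes "pairing Q" shows "computable2 Q"
proof -
  obtain r where r: "\<And>x y. reval r [x, y] = Some (Q x y)"
    using assms unfolding pairing_def computable2_on_def by blast
  have "recursive_at 2 (\<lambda>xs. Q (xs ! 0) (xs ! 1))"
    unfolding recursive_at_def by (rule exI[of _ r]) (auto simp: length_2_conv r)
  then have "recursive_at 1 (\<lambda>xs. Q (p1 (xs ! 0)) (p2 (xs ! 0)))"
    by (rule recursive_at_comp2)
      (use computable_p1_fun computable_p2_fun in \<open>simp_all add: computable_iff_recursive_at\<close>)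
  then show ?thesis
    by (simp add: computable2_def computable_iff_recursive_at)
qed

context pairings
begin

text \<open>
  Hilbert's hotel: a reduction of \<open>C \<oplus> D\<close> to \<open>C\<close> sends each element of \<open>D\<close> into \<open>C\<close>, and iterating
  its restriction to \<open>C\<close> yields infinitely many further elements of \<open>C\<close> of the same colour.
\<close>

lemma is_cylinder_if_join_le:
  assumes Q: "pairing Q" and le: "join P C D \<le>\<^sub>1 C" and VD: "V \<le>\<^sub>b\<^sub>f\<^sub>o D" and CV: "C \<le>\<^sub>b\<^sub>f\<^sub>o V"
  shows "is_cylinder Q V"
proof -
  obtain F where F: "computable F" "inj F" "\<And>x. x \<in> join P C D \<longleftrightarrow> F x \<in> C"
    using le unfolding one_red_iff one_reduction_def by blast
  obtain f where f: "computable f" "\<And>x. x \<in> V \<longleftrightarrow> f x \<in> D"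
    using VD unfolding bfo_red_def many_one_reduction_def by blast
  obtain g where g: "computable g" "\<And>x. x \<in> C \<longleftrightarrow> g x \<in> V" "bounded_finite_one g"
    using CV unfolding bfo_red_def many_one_reduction_def by blast
  \<comment> \<open>The orbit enters \<open>C\<close> once through the \<open>D\<close> side and
    then circulates on the \<open>C\<close> side.\<close>
  define orb where "orb x t = rec_nat (F (P 2 (Suc 0) (f x))) (\<lambda>_ c. F (P 2 0 c)) t" for x t
  have inl: "computable (P 2 0)" and inr: "computable (P 2 (Suc 0))"
    using computable_finite_pairing[OF fp2] by auto
  have "computable2 orb"
    unfolding computable2_def orb_def
    by (intro computable_intros computable_app[OF F(1)] computable_app[OF inl] computable_app[OF inr]
        computable_app[OF f(1)])
  \<comment> \<open>\<open>F\<close> is injective and the first point comes from the right copy, so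
    no later point, coming from the left copy, can return to it.\<close>
  have orb_inj: "orb x t = orb x t' \<Longrightarrow> t = t'" for x t t'
  proof (induction t arbitrary: t')
    case 0
    then show ?case
      by (cases t') (auto simp: orb_def inj_eq[OF F(2)])
  next
    case (Suc t)
    then obtain u where "t' = Suc u"
      by (cases t') (auto simp: orb_def inj_eq[OF F(2)])
    then show ?case
      using Suc by (simp add: orb_def inj_eq[OF F(2)])
  qed
  have orb_mem: "orb x t \<in> C \<longleftrightarrow> x \<in> V" for x t
    by (induction t) (simp_all add: orb_def f(2) flip: F(3))
  have Q2: "computable2 Q"
    using Q by (rule computable2_pairing)
  have Q_inj: "Q x t = Q y u \<longleftrightarrow> x = y \<and> t = u" for x t y u
    using Q inj_eq[of "\<lambda>(x, t). Q x t" "(x, t)" "(y, u)"] unfolding pairing_def bij_def by simp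
  have Q_surj: "\<exists>x t. Q x t = n" for n
  proof -
    obtain z where "n = (\<lambda>(x, t). Q x t) z"
      using Q surjD[of "\<lambda>(x, t). Q x t" n] unfolding pairing_def bij_def by blast
    then show ?thesis
      by (cases z) auto
  qed
  \<comment> \<open>The first component of \<open>n\<close> under \<open>Q\<close>, computed by
    searching for the pair coded by \<open>n\<close>.\<close>
  define X where "X n = p1 (LEAST z. Q (p1 z) (p2 z) = n)" for n
  have Q_ex: "\<exists>z. Q (p1 z) (p2 z) = n" for n
  proof -
    obtain x t where "Q x t = n"
      using Q_surj by blast
    then show ?thesis
      by (intro exI[of _ "pr x t"]) simp
  qed
  have "computable X"
    unfolding X_def by (intro computable_intros computable_app2[OF Q2] Q_ex)
  have X: "n \<in> Cyl Q V \<longleftrightarrow> X n \<in> V" for n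
  proof -
    define z where "z = (LEAST z. Q (p1 z) (p2 z) = n)"
    have n: "Q (X n) (p2 z) = n"
      using LeastI_ex[OF Q_ex[of n]] by (simp add: X_def z_def)
    have "Q (X n) (p2 z) \<in> Cyl Q V \<longleftrightarrow> X n \<in> V"
      by (auto simp: Cyl_def Q_inj)
    then show ?thesis
      unfolding n .
  qed
  \<comment> \<open>For each \<open>n\<close> this enumerates numbers with the colour of
    \<open>X n\<close> in \<open>V\<close>; there are infinitely many because \<open>g\<close> is
    finite-to-one on the infinite orbit.\<close>
  have "computable2 (\<lambda>n t. g (orb (X n) t))"
    unfolding computable2_def
    by (intro computable_app[OF g(1)] computable_app2[OF \<open>computable2 orb\<close>] computable_app[OF \<open>computable X\<close>]
        computable_intros)
  moreover have "infinite (range (\<lambda>t. g (orb (X n) t)))" for n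
  proof -
    have "infinite (range (orb (X n)))"
      using finite_imageD[of "orb (X n)" UNIV] orb_inj infinite_UNIV_nat by (auto intro: injI)
    then show ?thesis
      using infinite_image_bounded_finite_one[OF g(3), of "range (orb (X n))"] by (simp add: image_image)
  qed
  ultimately obtain G where G: "computable G" "strict_mono G" "\<And>n. \<exists>t. G n = g (orb (X n) t)"
    using increasing_choice[of "\<lambda>n t. g (orb (X n) t)"] by blast
  have "n \<in> Cyl Q V \<longleftrightarrow> G n \<in> V" for n
  proof -
    obtain t where "G n = g (orb (X n) t)"
      using G(3) by blast
    then show ?thesis
      by (simp add: X orb_mem flip: g(2))
  qed
  then have "one_reduction G (Cyl Q V) V"
    using G(1,2) strict_mono_imp_inj_on[of G UNIV] unfolding one_reduction_def by simp
  moreover have "one_reduction (\<lambda>x. Q x 0) V (Cyl Q V)"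
    unfolding one_reduction_def
  proof (intro conjI allI)
    show "computable (\<lambda>x. Q x 0)"
      by (intro computable_app2[OF Q2] computable_intros)
    show "inj (\<lambda>x. Q x 0)"
      by (simp add: inj_def Q_inj)
    show "x \<in> V \<longleftrightarrow> Q x 0 \<in> Cyl Q V" for x
      by (auto simp: Cyl_def Q_inj)
  qed
  ultimately show ?thesis
    unfolding is_cylinder_def one_equiv_def one_red_iff by blast
qed

end

section \<open>Cancellation\<close>

text \<open>Association lists coded by numbers; \<open>lookup\<close> returns 0 on keys that do not occur.\<close>

definition update :: "nat \<Rightarrow> nat \<Rightarrow> nat \<Rightarrow> nat" where
  "update d z v = Suc (pr z (pr v d))"

text \<open>One step of the list traversal, stationary at the end and at the key \<open>w\<close>.
  Surplus iterations are therefore harmless, and \<open>lookup\<close> can use the code itself as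
  the number of steps.\<close>

definition advance :: "nat \<Rightarrow> nat \<Rightarrow> nat" where
  "advance w c = (if c = 0 then c else if p1 (c - 1) = w then c else p2 (p2 (c - 1)))"

definition lookup :: "nat \<Rightarrow> nat \<Rightarrow> nat" where
  "lookup d w = (let c = rec_nat d (\<lambda>_. advance w) d in if c = 0 then 0 else p1 (p2 (c - 1)))"

lemma rec_nat_eq_funpow: "rec_nat c (\<lambda>_. f) n = (f ^^ n) c"
  by (induction n) auto

lemma funpow_fixed: "f c = c \<Longrightarrow> (f ^^ n) c = c"
  by (induction n) auto

lemma p2_le: "p2 z \<le> z"
  by (metis le_prod_encode_2 pr_def pr_p1_p2)

lemma advance_less: "advance w c \<noteq> c \<Longrightarrow> advance w c < c"
  unfolding advance_def using p2_le[of "p2 (c - 1)"] p2_le[of "c - 1"] by (auto split: if_splits)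

text \<open>The code strictly decreases until the traversal stops, so \<open>c\<close> steps are
  enough.\<close>

lemma funpow_advance: "c \<le> n \<Longrightarrow> (advance w ^^ n) c = (advance w ^^ c) c"
proof (induction c arbitrary: n rule: less_induct)
  case (less c)
  show ?case
  proof (cases "advance w c = c")
    case True
    then show ?thesis by (simp add: funpow_fixed)
  next
    case False
    then have lt: "advance w c < c"
      by (rule advance_less)
    then obtain c' n' where eq: "c = Suc c'" "n = Suc n'"
      using less.prems by (cases c; cases n) auto
    have "(advance w ^^ n) c = (advance w ^^ n') (advance w c)"
      unfolding eq(2) by (simp add: funpow_swap1)
    also have "\<dots> = (advance w ^^ advance w c) (advance w c)"
      using lt less.prems eq by (intro less.IH) auto
    also have "\<dots> = (advance w ^^ c') (advance w c)"
      using lt eq by (intro less.IH[symmetric]) auto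
    also have "\<dots> = (advance w ^^ c) c"
      unfolding eq(1) by (simp add: funpow_swap1)
    finally show ?thesis .
  qed
qed

lemma lookup_0 [simp]: "lookup 0 w = 0"
  by (simp add: lookup_def)

lemma lookup_update [simp]: "lookup (update d z v) w = (if w = z then v else lookup d w)"
proof (cases "w = z")
  case True
  then have "(advance w ^^ update d z v) (update d z v) = update d z v"
    by (intro funpow_fixed) (simp add: advance_def update_def)
  then show ?thesis
    using True by (simp add: lookup_def rec_nat_eq_funpow) (simp add: update_def)
next
  case False
  \<comment> \<open>One step passes the head; the remaining \<open>pr z (pr v d)\<close> steps still
    suffice for the tail \<open>d\<close>.\<close>
  have "d \<le> pr z (pr v d)"
    using p2_le[of "pr z (pr v d)"] p2_le[of "pr v d"] by simp
  have "(advance w ^^ update d z v) (update d z v) = (advance w ^^ pr z (pr v d)) d"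
    using False by (simp add: update_def funpow_swap1) (simp add: advance_def)
  also have "\<dots> = (advance w ^^ d) d"
    by (rule funpow_advance) fact
  finally show ?thesis
    using False by (simp add: lookup_def rec_nat_eq_funpow)
qed

lemma computable2_lookup: "computable2 lookup"
  unfolding computable2_def lookup_def Let_def advance_def by (intro computable_intros)


text \<open>
  The numbers \<open>s = 0, 1, \<dots>\<close> on the \<open>X\<close> side are treated in turn.  Iterating the reduction \<open>F\<close> of
  \<open>C \<oplus> X\<close> to \<open>C \<oplus> Y\<close> from \<open>s\<close>, one either leaves the \<open>C\<close> side at an unused \<open>z\<close> on the \<open>Y\<close> side, or
  visits so many numbers on the \<open>C\<close> side that \<open>psi\<close> maps one of them to an unused \<open>z\<close>; either way \<open>z\<close>
  has the colour of \<open>s\<close>.  Sending \<open>s\<close> to \<open>z\<close> and redirecting arrivals at \<open>z\<close>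
  to the image of \<open>s\<close> leaves a reduction of the same kind on the remaining elements.
\<close>

locale cancellation = pairings P
  for P :: "nat \<Rightarrow> nat \<Rightarrow> nat \<Rightarrow> nat" +
  fixes C X Y :: "nat set" and F psi side body :: "nat \<Rightarrow> nat" and k :: nat
  assumes F: "computable F" "inj F" "\<And>w. w \<in> join P C X \<longleftrightarrow> F w \<in> join P C Y"
    and psi: "computable psi" "\<And>c. c \<in> C \<longleftrightarrow> psi c \<in> Y"
      "\<And>y. finite (psi -` {y})" "\<And>y. card (psi -` {y}) \<le> k"
    and side: "computable side" "\<And>x. side (P 2 0 x) = 0" "\<And>x. side (P 2 (Suc 0) x) = 1"
    and body: "computable body" "\<And>x. body (P 2 0 x) = x" "\<And>x. body (P 2 (Suc 0) x) = x"
begin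

abbreviation inl :: "nat \<Rightarrow> nat" where "inl \<equiv> P 2 0"
abbreviation inr :: "nat \<Rightarrow> nat" where "inr \<equiv> P 2 (Suc 0)"

text \<open>Stored values are shifted by one, since 0 marks an absent key.\<close>

definition redirect :: "nat \<Rightarrow> nat \<Rightarrow> nat" where
  "redirect d v = (if lookup d v = 0 then v else lookup d v - 1)"

definition start :: "nat \<Rightarrow> nat \<Rightarrow> nat" where
  "start d s = redirect d (F (inr s))"

definition chain :: "nat \<Rightarrow> nat \<Rightarrow> nat \<Rightarrow> nat" where
  "chain d s t = rec_nat (start d s) (\<lambda>_ v. redirect d (F v)) t"

definition candidate :: "nat \<Rightarrow> nat" where
  "candidate v = (if side v = 0 then inr (psi (body v)) else v)"

definition bound :: "nat \<Rightarrow> nat" where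
  "bound s = rec_nat 0 (\<lambda>_ b. b + k) s"

text \<open>
  The bound only makes the search total for arbitrary \<open>d\<close>; on the states that actually occur, the
  pigeonhole principle yields a fresh candidate within it.
\<close>

definition stop :: "nat \<Rightarrow> nat \<Rightarrow> nat" where
  "stop d s = (LEAST t. lookup d (candidate (chain d s t)) = 0 \<or> bound s \<le> t)"

definition choice :: "nat \<Rightarrow> nat \<Rightarrow> nat" where
  "choice d s = candidate (chain d s (stop d s))"

text \<open>The table after \<open>s\<close> rounds: its keys are the numbers already given away,
  each stored with the place to which arrivals at it are diverted.\<close>

definition state :: "nat \<Rightarrow> nat" where
  "state s = rec_nat 0 (\<lambda>s d. update d (choice d s) (Suc (start d s))) s"

lemma bound_eq: "bound s = s * k"
  by (induction s) (auto simp: bound_def)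

section \<open>Computability of the cancellation procedure\<close>

lemma computable_inl: "computable inl" and computable_inr: "computable inr"
  using computable_finite_pairing[OF fp2] by auto

lemma computable2_redirect: "computable2 redirect"
  unfolding computable2_def redirect_def
  by (intro computable_intros computable_app2[OF computable2_lookup])

lemma computable2_start: "computable2 start"
  unfolding computable2_def start_def
  by (intro computable_intros computable_app2[OF computable2_redirect] computable_app[OF F(1)]
      computable_app[OF computable_inr])

lemma computable_chain:
  assumes "computable d" "computable s" "computable t"
  shows "computable (\<lambda>x. chain (d x) (s x) (t x))"
  unfolding chain_def
  by (intro computable_intros computable_app2[OF computable2_redirect] computable_app[OF F(1)]
      computable_app2[OF computable2_start] computable_app[OF assms(1)] assms)

lemma computable_candidate: "computable candidate"
  unfolding candidate_def
  by (intro computable_intros computable_app[OF computable_inr] computable_app[OF psi(1)]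
      computable_app[OF side(1)] body(1))

lemma computable_bound: "computable bound"
  unfolding bound_def by (intro computable_intros)

lemma computable2_stop: "computable2 stop"
  unfolding computable2_def stop_def
  by (intro computable_intros computable_app2[OF computable2_lookup] computable_app[OF computable_candidate]
      computable_chain computable_app[OF computable_bound]) auto

lemma computable2_choice: "computable2 choice"
  unfolding computable2_def choice_def
  by (intro computable_intros computable_app[OF computable_candidate]
      computable_chain computable_app2[OF computable2_stop])

lemma computable_state: "computable state"
  unfolding state_def update_def
  by (intro computable_intros computable_app2[OF computable2_choice] computable_app2[OF computable2_start])

text \<open>The arguments of \<open>F\<close> still to be kept apart: the whole left copy and the
  part of the right copy not yet treated.\<close>

definition active :: "nat \<Rightarrow> nat set" where
  "active s = range inl \<union> inr ` {s..}"

lemma inl_active [simp]: "inl c \<in> active s"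
  by (simp add: active_def)

lemma inr_active [simp]: "inr x \<in> active s \<longleftrightarrow> s \<le> x"
  by (auto simp: active_def)

lemma inl_or_inr: obtains c where "v = inl c" | y where "v = inr y"
proof -
  obtain i x where "i < 2" "v = P 2 i x"
    using finite_pairing_surj[OF fp2] by blast
  then show ?thesis
    using that by (auto simp: less_2_cases_iff)
qed

definition invar :: "nat \<Rightarrow> nat \<Rightarrow> bool" where
  "invar s d \<longleftrightarrow>
    finite {w. lookup d w \<noteq> 0} \<and> card {w. lookup d w \<noteq> 0} \<le> s \<and>
    (\<forall>v. redirect d v \<in> join P C Y \<longleftrightarrow> v \<in> join P C Y) \<and>
    (\<forall>w. lookup d w \<noteq> 0 \<longrightarrow> (\<exists>c. redirect d w = inl c) \<or> lookup d (redirect d w) \<noteq> 0) \<and>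
    inj_on (\<lambda>w. redirect d (F w)) (active s) \<and>
    (\<forall>w\<in>active s. lookup d (redirect d (F w)) = 0)"

section \<open>Correctness of a single round\<close>

context
  fixes s d
  assumes inv: "invar s d"
begin

lemma finite_keys: "finite {w. lookup d w \<noteq> 0}"
  and card_keys: "card {w. lookup d w \<noteq> 0} \<le> s"
  and redirect_mem: "redirect d v \<in> join P C Y \<longleftrightarrow> v \<in> join P C Y"
  and redirect_key: "lookup d w \<noteq> 0 \<Longrightarrow> (\<exists>c. redirect d w = inl c) \<or> lookup d (redirect d w) \<noteq> 0"
  and inj_active: "inj_on (\<lambda>w. redirect d (F w)) (active s)"
  and active_fresh: "w \<in> active s \<Longrightarrow> lookup d (redirect d (F w)) = 0"
  using inv unfolding invar_def by blast+

lemma chain_0: "chain d s 0 = redirect d (F (inr s))"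
  and chain_Suc: "chain d s (Suc t) = redirect d (F (chain d s t))"
  by (simp_all add: chain_def start_def)

lemma candidate_inl: "candidate (inl c) = inr (psi c)"
  and candidate_inr: "candidate (inr y) = inr y"
  by (simp_all add: candidate_def side body)

text \<open>Chain members are never keys, and a member on the right is its own candidate. So as long
  as all candidates are used, the chain stays on the left, where redirected \<open>F\<close>
  transports the colour of \<open>s\<close>.\<close>

lemma chain_not_fresh:
  assumes "\<And>u. u < t \<Longrightarrow> lookup d (candidate (chain d s u)) \<noteq> 0"
  shows "lookup d (chain d s t) = 0 \<and> (chain d s t \<in> join P C Y \<longleftrightarrow> s \<in> X) \<and>
    (\<forall>u<t. \<exists>c. chain d s u = inl c)"
  using assms
proof (induction t)
  case 0
  then show ?case
    by (simp add: chain_0 active_fresh redirect_mem flip: F(3))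
next
  case (Suc t)
  then have IH: "lookup d (chain d s t) = 0" "chain d s t \<in> join P C Y \<longleftrightarrow> s \<in> X"
    "\<forall>u<t. \<exists>c. chain d s u = inl c"
    by auto
  obtain c where c: "chain d s t = inl c"
    using Suc.prems[of t] IH(1) candidate_inr by (cases rule: inl_or_inr[of "chain d s t"]) auto
  then show ?case
    using IH by (simp add: chain_Suc active_fresh redirect_mem less_Suc_eq flip: F(3))
qed

text \<open>As for orbits: redirected \<open>F\<close> is injective on active arguments, and the
  chain starts from \<open>inr s\<close>, which differs from every \<open>inl c\<close>.\<close>

lemma chain_inj:
  assumes "\<And>u. u < t \<Longrightarrow> \<exists>c. chain d s u = inl c"
  shows "inj_on (chain d s) {..t}"
proof -
  have "chain d s i \<noteq> chain d s j" if "i < j" "j \<le> t" for i j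
    using that
  proof (induction i arbitrary: j)
    case 0
    then obtain j' where j: "j = Suc j'"
      by (cases j) auto
    then obtain c where "chain d s j' = inl c"
      using assms[of j'] 0 by auto
    then show ?case
      using inj_onD[OF inj_active, of "inr s" "inl c"] j by (auto simp: chain_0 chain_Suc)
  next
    case (Suc i)
    then obtain j' where j: "j = Suc j'"
      by (cases j) auto
    obtain c c' where c: "chain d s i = inl c" "chain d s j' = inl c'"
      using assms[of i] assms[of j'] Suc.prems j by auto
    then show ?case
      using inj_onD[OF inj_active, of "inl c" "inl c'"] Suc.IH[of j'] Suc.prems j
      by (auto simp: chain_Suc)
  qed
  then show ?thesis
    by (intro inj_onI) (metis atMost_iff nat_neq_iff)
qed

lemma stop_before:
  assumes "u < stop d s"
  shows "lookup d (candidate (chain d s u)) \<noteq> 0"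
  using not_less_Least[OF assms[unfolded stop_def]] by simp

text \<open>Otherwise more than \<open>s * k\<close> distinct left numbers are mapped by
  \<open>psi\<close> to bodies of keys, while at most \<open>s\<close> keys with at most
  \<open>k\<close> preimages each are available.\<close>

lemma lookup_choice: "lookup d (choice d s) = 0"
proof (rule ccontr)
  assume ne: "lookup d (choice d s) \<noteq> 0"
  have "lookup d (choice d s) = 0 \<or> bound s \<le> stop d s"
    unfolding choice_def stop_def by (rule LeastI[of _ "bound s"]) simp
  then have le: "s * k \<le> stop d s"
    using ne by (simp add: bound_eq)
  have nf: "lookup d (candidate (chain d s u)) \<noteq> 0" if "u < Suc (stop d s)" for u
    using that stop_before ne unfolding choice_def less_Suc_eq by blast
  have inl: "\<exists>c. chain d s u = inl c" if "u < Suc (stop d s)" for u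
    using chain_not_fresh[of "Suc (stop d s)"] nf that by blast
  let ?W = "{w. lookup d w \<noteq> 0}" and ?c = "\<lambda>u. body (chain d s u)"
  have "inj_on ?c {..stop d s}"
  proof (rule inj_onI)
    fix u v assume uv: "u \<in> {..stop d s}" "v \<in> {..stop d s}" "?c u = ?c v"
    then have "chain d s u = chain d s v"
      using inl[of u] inl[of v] by (auto simp: body less_Suc_eq_le)
    then show "u = v"
      using chain_inj[of "stop d s"] inl uv by (auto dest: inj_onD)
  qed
  then have "Suc (stop d s) = card (?c ` {..stop d s})"
    by (simp add: card_image)
  also have "\<dots> \<le> card (\<Union>w\<in>?W. psi -` {body w})"
  proof (rule card_mono)
    show "finite (\<Union>w\<in>?W. psi -` {body w})"
      using finite_keys psi(3) by blast
    show "?c ` {..stop d s} \<subseteq> (\<Union>w\<in>?W. psi -` {body w})"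
    proof
      fix c assume "c \<in> ?c ` {..stop d s}"
      then obtain u where u: "u < Suc (stop d s)" "c = ?c u"
        by (auto simp: less_Suc_eq_le)
      then have "chain d s u = inl c"
        using inl[OF u(1)] by (auto simp: body)
      then have "inr (psi c) \<in> ?W"
        using nf[OF u(1)] by (simp add: candidate_inl)
      then show "c \<in> (\<Union>w\<in>?W. psi -` {body w})"
        by (intro UN_I[of "inr (psi c)"]) (auto simp: body)
    qed
  qed
  also have "\<dots> \<le> (\<Sum>w\<in>?W. card (psi -` {body w}))"
    using finite_keys by (rule card_UN_le)
  also have "\<dots> \<le> (\<Sum>w\<in>?W. k)"
    by (intro sum_mono psi(4))
  also have "\<dots> \<le> s * k"
    using card_keys by simp
  finally show False
    using le by simp
qed

lemma choice_inr: "\<exists>y. choice d s = inr y"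
  unfolding choice_def by (cases rule: inl_or_inr[of "chain d s (stop d s)"]) (auto simp: candidate_inl candidate_inr)

lemma choice_mem: "choice d s \<in> join P C Y \<longleftrightarrow> s \<in> X"
proof -
  have "chain d s (stop d s) \<in> join P C Y \<longleftrightarrow> s \<in> X"
    using chain_not_fresh[of "stop d s"] stop_before by blast
  then show ?thesis
    unfolding choice_def
    by (cases rule: inl_or_inr[of "chain d s (stop d s)"]) (auto simp: candidate_inl candidate_inr psi(2))
qed

lemma start_inr: "start d s = inr y \<Longrightarrow> choice d s = inr y"
proof -
  assume y: "start d s = inr y"
  then have "chain d s 0 = inr y"
    by (simp add: chain_def)
  moreover have "lookup d (inr y) = 0"
    using active_fresh[of "inr s"] y by (simp add: start_def)
  ultimately have "stop d s = 0"
    unfolding stop_def by (intro Least_eq_0) (simp add: candidate_inr)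
  then show "choice d s = inr y"
    using \<open>chain d s 0 = inr y\<close> by (simp add: choice_def candidate_inr)
qed

lemma redirect_eq_choice: "redirect d v = choice d s \<longleftrightarrow> v = choice d s"
proof
  assume "redirect d v = choice d s"
  then show "v = choice d s"
    using redirect_key[of v] lookup_choice choice_inr unfolding redirect_def by (auto split: if_splits)
qed (simp add: redirect_def lookup_choice)

text \<open>The value \<open>v\<close> was attained only at \<open>inr s\<close>, which leaves the
  active set; diverting arrivals at \<open>z\<close> to the vacated \<open>v\<close> thus keeps
  redirected \<open>F\<close> injective.\<close>

lemma invar_step: "invar (Suc s) (update d (choice d s) (Suc (start d s)))" (is "invar _ ?d")
proof -
  define z v where "z = choice d s" and "v = start d s"
  have d': "?d = update d z (Suc v)"
    by (simp add: z_def v_def)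
  have keys: "{w. lookup ?d w \<noteq> 0} = insert z {w. lookup d w \<noteq> 0}"
    by (auto simp: d')
  have redirect': "redirect ?d w = (if w = z then v else redirect d w)" for w
    by (simp add: redirect_def d')
  have step: "redirect ?d (F w) = (if redirect d (F w) = z then v else redirect d (F w))" for w
    unfolding redirect' using redirect_eq_choice by (simp add: z_def)
  have v_eq: "v = redirect d (F (inr s))"
    by (simp add: v_def start_def)
  have active: "w \<in> active s" "w \<noteq> inr s" if "w \<in> active (Suc s)" for w
    using that by (auto simp: active_def)
  have ne: "redirect d (F w) \<noteq> v" if "w \<in> active (Suc s)" for w
    using inj_onD[OF inj_active, of w "inr s"] active[OF that] unfolding v_eq by auto
  show ?thesis
    unfolding invar_def
  proof (intro conjI)
    show "finite {w. lookup ?d w \<noteq> 0}"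
      unfolding keys using finite_keys by simp
    show "card {w. lookup ?d w \<noteq> 0} \<le> Suc s"
      unfolding keys using card_keys finite_keys by (simp add: card_insert_if)
    have "v \<in> join P C Y \<longleftrightarrow> z \<in> join P C Y"
      unfolding v_eq z_def by (simp add: redirect_mem choice_mem flip: F(3))
    then show "\<forall>w. redirect ?d w \<in> join P C Y \<longleftrightarrow> w \<in> join P C Y"
      by (simp add: redirect' redirect_mem)
    show "\<forall>w. lookup ?d w \<noteq> 0 \<longrightarrow> (\<exists>c. redirect ?d w = inl c) \<or> lookup ?d (redirect ?d w) \<noteq> 0"
    proof (intro allI impI)
      fix w assume w: "lookup ?d w \<noteq> 0"
      show "(\<exists>c. redirect ?d w = inl c) \<or> lookup ?d (redirect ?d w) \<noteq> 0"
      proof (cases "w = z")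
        case True
        then have "redirect ?d w = v"
          by (simp add: redirect')
        then show ?thesis
          using start_inr by (cases rule: inl_or_inr[of v]) (auto simp: v_def z_def)
      next
        case False
        then have "redirect ?d w = redirect d w" "lookup d w \<noteq> 0"
          using w by (simp_all add: redirect') (simp add: z_def)
        then show ?thesis
          using redirect_key[of w] by (auto simp: d')
      qed
    qed
    show "inj_on (\<lambda>w. redirect ?d (F w)) (active (Suc s))"
    proof (rule inj_onI)
      fix w w' assume w: "w \<in> active (Suc s)" "w' \<in> active (Suc s)"
        and "redirect ?d (F w) = redirect ?d (F w')"
      then have "redirect d (F w) = redirect d (F w')"
        using ne[OF w(1)] ne[OF w(2)] unfolding step by (auto split: if_splits)
      then show "w = w'"
        using inj_onD[OF inj_active] active(1) w by blast
    qed
    show "\<forall>w\<in>active (Suc s). lookup ?d (redirect ?d (F w)) = 0"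
    proof
      fix w assume w: "w \<in> active (Suc s)"
      have "lookup d v = 0"
        unfolding v_eq by (rule active_fresh) simp
      moreover have "lookup d (redirect d (F w)) = 0"
        using active(1)[OF w] by (rule active_fresh)
      \<comment> \<open>If \<open>w\<close> used to arrive at \<open>z\<close>, then
        \<open>z\<close> differs from the vacated \<open>v\<close>, so its new value
        \<open>v\<close> is not the new key either.\<close>
      ultimately show "lookup ?d (redirect ?d (F w)) = 0"
        using ne[OF w] unfolding step by (auto simp: d')
    qed
  qed
qed

end

lemma invar_state: "invar s (state s)"
proof (induction s)
  case 0
  have "redirect 0 w = w" for w
    by (simp add: redirect_def)
  then show ?case
    using F(2) by (auto simp: invar_def state_def intro: inj_onI dest: injD)
next
  case (Suc s)
  then show ?case
    using invar_step by (simp add: state_def)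
qed

text \<open>Numbers once given away remain keys; as each choice is a non-key of its own state, all
  choices are distinct.\<close>

lemma lookup_state: "i < s \<Longrightarrow> lookup (state s) (choice (state i) i) \<noteq> 0"
proof (induction s)
  case (Suc s)
  have "state (Suc s) = update (state s) (choice (state s) s) (Suc (start (state s) s))"
    by (simp add: state_def)
  then show ?case
    using Suc by (auto simp: less_Suc_eq)
qed simp

lemma cancel: "X \<le>\<^sub>1 Y"
proof -
  let ?z = "\<lambda>s. choice (state s) s"
  have z: "inr (body (?z s)) = ?z s" for s
    using choice_inr[OF invar_state, of s] by (auto simp: body)
  have "computable (\<lambda>s. body (?z s))"
    by (intro computable_app[OF body(1)] computable_app2[OF computable2_choice] computable_state computable_id)
  moreover have "inj (\<lambda>s. body (?z s))"
  proof -
    have "?z i \<noteq> ?z s" if "i < s" for i s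
      using lookup_state[OF that] lookup_choice[OF invar_state, of s] by metis
    then have "inj ?z"
      by (metis (mono_tags, lifting) injI nat_neq_iff)
    then show ?thesis
      using z by (metis (mono_tags, lifting) injI injD)
  qed
  moreover have "s \<in> X \<longleftrightarrow> body (?z s) \<in> Y" for s
    using choice_mem[OF invar_state, of s] z[of s] mem_join(2)[of "body (?z s)" C Y] by simp
  ultimately show ?thesis
    unfolding one_red_iff one_reduction_def by blast
qed

end

context pairings
begin

lemma join_cancel:
  assumes le: "join P C X \<le>\<^sub>1 join P C Y" and CY: "C \<le>\<^sub>b\<^sub>f\<^sub>o Y"
  shows "X \<le>\<^sub>1 Y"
proof -
  obtain F where F: "one_reduction F (join P C X) (join P C Y)"
    using le unfolding one_red_iff by blast
  obtain psi k where psi: "many_one_reduction psi C Y" "\<And>y. finite (psi -` {y}) \<and> card (psi -` {y}) \<le> k"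
    using CY unfolding bfo_red_def bounded_finite_one_def by blast
  obtain side body where sb: "computable side" "computable body"
    and inv: "\<forall>i<2. \<forall>x. side (P 2 i x) = i \<and> body (P 2 i x) = x"
    by (rule finite_pairingE[OF fp2]) blast
  interpret cancellation P C X Y F psi side body k
    by unfold_locales
      (use F psi sb inv in \<open>auto simp: one_reduction_def many_one_reduction_def\<close>)
  show ?thesis
    by (rule cancel)
qed

section \<open>Decomposition of a bounded finite-one reduction\<close>

text \<open>Inside the reservoir \<open>R\<close> of non-members everything has the same colour, so
  \<open>R\<close> can be moved injectively into itself to make room for one more copy of the
  natural numbers.\<close>

lemma join_empty_le:
  assumes "has_computable_reservoirs V" shows "join P V {} \<le>\<^sub>1 V"
proof -
  obtain R where R: "computable_set R" "infinite R" "R \<subseteq> - V"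
    using assms unfolding has_computable_reservoirs_def by blast
  obtain r where r: "r \<in> R"
    using infinite_imp_nonempty[OF R(2)] by blast
  have dec: "decidable (\<lambda>x. x \<in> R)"
    using R(1) by (simp add: computable_set_def decidable_def)
  \<comment> \<open>The default \<open>r\<close> from \<open>R\<close> makes the enumeration of
    \<open>R\<close> total.\<close>
  have "computable2 (\<lambda>n t. if t \<in> R then t else r)"
    unfolding computable2_def by (intro computable_intros decidable_app[OF dec])
  moreover have "infinite (range (\<lambda>t. if t \<in> R then t else r))"
  proof -
    have "R \<subseteq> range (\<lambda>t. if t \<in> R then t else r)"
      by (auto simp: image_iff)
    then show ?thesis
      using R(2) finite_subset by blast
  qed
  ultimately obtain G where G: "computable G" "strict_mono G"
    "\<And>n. \<exists>t. G n = (if t \<in> R then t else r)"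
    using increasing_choice[of "\<lambda>n t. if t \<in> R then t else r"] by blast
  have GR: "G n \<in> R" for n
    using G(3)[of n] r by (auto split: if_splits)
  then have GV: "G n \<notin> V" for n
    using R(3) by blast
  have G_eq: "G x = G y \<longleftrightarrow> x = y" for x y
    using strict_mono_eq[OF G(2)] .
  \<comment> \<open>Elements of \<open>R\<close> occupy the even positions of \<open>G\<close>,
    everything else stays fixed, and the odd positions host the empty set.\<close>
  let ?f = "\<lambda>y. if y \<in> R then G (y + y) else y"
  show ?thesis
  proof (rule join_le)
    have "computable ?f"
      by (intro computable_intros decidable_app[OF dec] computable_app[OF G(1)])
    moreover have "inj ?f"
      using GR by (intro injI) (auto simp: G_eq split: if_splits)
    moreover have "x \<in> V \<longleftrightarrow> ?f x \<in> V" for x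
      using GV R(3) by auto
    ultimately show "one_reduction ?f V V"
      unfolding one_reduction_def by blast
    have "computable (\<lambda>x. G (Suc (x + x)))"
      by (intro computable_app[OF G(1)] computable_intros)
    moreover have "inj (\<lambda>x. G (Suc (x + x)))"
      by (rule injI) (simp add: G_eq)
    ultimately show "one_reduction (\<lambda>x. G (Suc (x + x))) {} V"
      using GV unfolding one_reduction_def by blast
    have "x + x \<noteq> Suc (y + y)" for x y :: nat
      by presburger
    then show "?f x \<noteq> G (Suc (y + y))" for x y
      using GR[of "Suc (y + y)"] by (auto simp: G_eq)
  qed
qed

text \<open>Each \<open>x\<close> is numbered by its position in its fibre under \<open>f\<close>;
  the piece \<open>X i\<close> collects the elements of \<open>B\<close> with number
  \<open>i\<close>. The \<open>k\<close> copies of \<open>V\<close> are dealt out, one to each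
  piece.\<close>

lemma gjoin_decomposition:
  assumes BV: "B \<le>\<^sub>b\<^sub>f\<^sub>o V" and V: "join P V {} \<le>\<^sub>1 V"
  obtains k X where "k \<ge> 1" "\<And>i. X i \<le>\<^sub>1 V"
    "join P (autojoin P k V) B \<equiv>\<^sub>1 gjoin (P k) k (\<lambda>i. join P V (X i))"
proof -
  obtain f k where f: "computable f" "\<And>x. x \<in> B \<longleftrightarrow> f x \<in> V"
    and k: "k \<ge> 1" "\<And>y. finite (f -` {y}) \<and> card (f -` {y}) \<le> k"
    using BV unfolding bfo_red_def many_one_reduction_def bounded_finite_one_def by blast
  obtain F where F: "one_reduction F (join P V {}) V"
    using V unfolding one_red_iff by blast
  \<comment> \<open>\<open>e\<close> embeds \<open>V\<close> in itself, and \<open>g\<close>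
    supplies an injective sequence of non-members outside the range of \<open>e\<close>.\<close>
  define e where "e x = F (P 2 0 x)" for x
  define g where "g x = F (P 2 (Suc 0) x)" for x
  have e: "one_reduction e V V" and g: "one_reduction g {} V"
    unfolding e_def g_def
    using one_reduction_comp[OF one_reduction_inl F] one_reduction_comp[OF one_reduction_inr F] by auto
  have eg: "e x \<noteq> g y" for x y
    using F unfolding one_reduction_def e_def g_def by (auto dest: injD)
  have ge: "g x \<noteq> e y" for x y
    using eg[of y x] by simp
  have e_eq: "e x = e y \<longleftrightarrow> x = y" and g_eq: "g x = g y \<longleftrightarrow> x = y" for x y
    using e g unfolding one_reduction_def by (auto dest: injD)
  define j where "j x = card {y. y < x \<and> f y = f x}" for x
  have j_rec: "j x = rec_nat 0 (\<lambda>y r. if f y = f x then Suc r else r) x" for x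
  proof -
    have "rec_nat 0 (\<lambda>y r. if f y = c then Suc r else r) n = card {y. y < n \<and> f y = c}" for n c
    proof (induction n)
      case (Suc n)
      have "{y. y < Suc n \<and> f y = c} =
          (if f n = c then insert n {y. y < n \<and> f y = c} else {y. y < n \<and> f y = c})"
        by (auto simp: less_Suc_eq)
      then show ?case
        using Suc by simp
    qed simp
    then show ?thesis
      by (simp add: j_def)
  qed
  have j: "computable j"
    unfolding j_rec[abs_def]
    by (intro computable_intros computable_app[OF f(1)])
  have j_less: "j x < k" for x
  proof -
    have "insert x {y. y < x \<and> f y = f x} \<subseteq> f -` {f x}"
      by auto
    then have "card (insert x {y. y < x \<and> f y = f x}) \<le> k"
      using k(2)[of "f x"] card_mono le_trans by blast
    then show ?thesis
      by (simp add: j_def)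
  qed
  have j_strict: "j x < j y" if "x < y" "f x = f y" for x y
    unfolding j_def
  proof (rule psubset_card_mono)
    show "{z. z < x \<and> f z = f x} \<subset> {z. z < y \<and> f z = f y}"
      using that by (intro psubsetI) auto
  qed simp
  have j_inj: "x = y" if "j x = j y" "f x = f y" for x y
    using j_strict[of x y] j_strict[of y x] that by (cases x y rule: linorder_cases) auto
  define X where "X i = {x \<in> B. j x = i}" for i
  have X: "X i \<le>\<^sub>1 V" for i
  proof -
    \<comment> \<open>On numbers with index \<open>i\<close> the map \<open>f\<close> is injective;
      all others lie outside \<open>X i\<close> and go to spare non-members.\<close>
    let ?h = "\<lambda>x. if j x = i then e (f x) else g x"
    have ce: "computable e" and cg: "computable g"
      using e g unfolding one_reduction_def by auto
    have "computable ?h"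
      by (intro computable_intros computable_app[OF j] computable_app[OF ce] computable_app[OF f(1)] cg)
    moreover have "inj ?h"
      by (intro injI) (auto simp: e_eq g_eq eg ge intro: j_inj split: if_splits)
    moreover have "x \<in> X i \<longleftrightarrow> ?h x \<in> V" for x
      using e g f(2) unfolding one_reduction_def X_def by auto
    ultimately show ?thesis
      unfolding one_red_iff one_reduction_def by blast
  qed
  have fp: "finite_pairing k (P k)"
    using k(1) by (rule fin_pair)
  note P_eq = finite_pairing_eq_iff[OF fp]
  let ?L = "join P (autojoin P k V) B" and ?R = "gjoin (P k) k (\<lambda>i. join P V (X i))"
  have "?L \<le>\<^sub>1 ?R"
  proof -
    have r1: "one_reduction (\<lambda>x. P k i (P 2 0 x)) V ?R" if "i < k" for i
      using one_reduction_comp[OF one_reduction_inl one_reduction_gjoin[OF fp that, of "\<lambda>i. join P V (X i)"]] .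
    have r2: "i = i'" if "i < k" "i' < k" "P k i (P 2 0 x) = P k i' (P 2 0 y)" for i i' x y
      using that by (simp add: P_eq)
    have "\<exists>G. one_reduction G (autojoin P k V) ?R \<and> (\<forall>i<k. \<forall>x. G (P k i x) = P k i (P 2 0 x))"
      unfolding autojoin_eq_gjoin
      by (rule gjoin_reduction[OF fp, of "\<lambda>i x. P k i (P 2 0 x)" "\<lambda>_. V" ?R, OF r1 r2]) blast+
    then obtain G where G: "one_reduction G (autojoin P k V) ?R"
      "\<And>i x. i < k \<Longrightarrow> G (P k i x) = P k i (P 2 0 x)"
      by blast
    have "computable (\<lambda>x. P k i (P 2 (Suc 0) x))" if "i < k" for i
      using computable_app[OF computable_finite_pairing[OF fp that] computable_finite_pairing[OF fp2, of "Suc 0"]]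
      by simp
    \<comment> \<open>\<open>H\<close> sends \<open>x\<close> to the right half of the block given
      by its fibre number, where it meets exactly the piece containing it.\<close>
    from computable_finite_cases[of k "\<lambda>i x. P k i (P 2 (Suc 0) x)", OF this j computable_id]
    obtain H where H: "computable H" "\<And>x. H x = P k (j x) (P 2 (Suc 0) x)"
      using j_less by auto
    have "one_reduction H B ?R"
      unfolding one_reduction_def
    proof (intro conjI allI)
      show "inj H"
        by (rule injI) (simp add: H(2) P_eq j_less)
      show "x \<in> B \<longleftrightarrow> H x \<in> ?R" for x
        by (simp add: H(2) mem_gjoin[OF fp] j_less X_def)
    qed (rule H(1))
    moreover have "G w \<noteq> H y" for w y
    proof -
      obtain i x where "i < k" "w = P k i x"
        using finite_pairing_surj[OF fp] by blast
      then show ?thesis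
        by (simp add: G(2) H(2) P_eq j_less)
    qed
    ultimately show ?thesis
      by (rule join_le[OF G(1)])
  qed
  moreover have "?R \<le>\<^sub>1 ?L"
  proof -
    \<comment> \<open>The range of each \<open>G\<close> is recorded: block \<open>i\<close> of the
      autojoin, or numbers with fibre number \<open>i\<close> on the \<open>B\<close> side. These
      are disjoint for different \<open>i\<close>.\<close>
    have "\<exists>G. one_reduction G (join P V (X i)) ?L \<and>
        (\<forall>w. (\<exists>y. G w = P 2 0 (P k i y)) \<or> (\<exists>x. G w = P 2 (Suc 0) x \<and> j x = i))" if i: "i < k" for i
    proof -
      let ?p = "\<lambda>x. P 2 0 (P k i x)"
      have p: "one_reduction ?p V ?L"
        using one_reduction_comp[OF one_reduction_gjoin[OF fp i, of "\<lambda>_. V"] one_reduction_inl]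
        by (simp add: autojoin_eq_gjoin)
      \<comment> \<open>Numbers with index \<open>i\<close> keep their place on the \<open>B\<close>
        side; the others are parked on non-members in block \<open>i\<close>, left free by
        \<open>e\<close>.\<close>
      let ?q = "\<lambda>x. if j x = i then P 2 (Suc 0) x else ?p (g x)"
      have "computable (\<lambda>x. ?p (g x))"
        by (rule computable_app[of ?p g]) (use g p in \<open>simp_all add: one_reduction_def\<close>)
      then have "computable ?q"
        using computable_finite_pairing[OF fp2, of "Suc 0"]
        by (intro computable_intros computable_app[OF j]) auto
      moreover have "inj ?q"
        by (intro injI) (auto simp: P_eq i g_eq split: if_splits)
      moreover have "x \<in> X i \<longleftrightarrow> ?q x \<in> ?L" for x
        using p g unfolding one_reduction_def X_def by auto
      ultimately have q: "one_reduction ?q (X i) ?L"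
        unfolding one_reduction_def by blast
      have "?p (e x) \<noteq> ?q y" for x y
        by (simp add: P_eq i eg)
      then have "\<exists>G. one_reduction G (join P V (X i)) ?L \<and>
          (\<forall>x. G (P 2 0 x) = ?p (e x)) \<and> (\<forall>x. G (P 2 (Suc 0) x) = ?q x)"
        by (rule join_reduction[OF one_reduction_comp[OF e p] q]) blast
      then obtain G where G: "one_reduction G (join P V (X i)) ?L"
        "\<And>x. G (P 2 0 x) = ?p (e x)" "\<And>x. G (P 2 (Suc 0) x) = ?q x"
        by blast
      have "(\<exists>y. G w = P 2 0 (P k i y)) \<or> (\<exists>x. G w = P 2 (Suc 0) x \<and> j x = i)" for w
      proof -
        obtain l x where "l < 2" "w = P 2 l x"
          using finite_pairing_surj[OF fp2] by blast
        then have "w = P 2 0 x \<or> w = P 2 (Suc 0) x"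
          by (auto simp: less_2_cases_iff)
        then show ?thesis
          using G(2)[of x] G(3)[of x] by (auto split: if_splits)
      qed
      then show ?thesis
        using G(1) by blast
    qed
    then have "\<forall>i\<in>{..<k}. \<exists>G. one_reduction G (join P V (X i)) ?L \<and>
        (\<forall>w. (\<exists>y. G w = P 2 0 (P k i y)) \<or> (\<exists>x. G w = P 2 (Suc 0) x \<and> j x = i))"
      by blast
    then obtain G where G: "\<And>i. i < k \<Longrightarrow> one_reduction (G i) (join P V (X i)) ?L"
      "\<And>i w. i < k \<Longrightarrow> (\<exists>y. G i w = P 2 0 (P k i y)) \<or> (\<exists>x. G i w = P 2 (Suc 0) x \<and> j x = i)"
      unfolding bchoice_iff by blast
    have "i = i'" if "i < k" "i' < k" "G i x = G i' y" for i i' x y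
      using G(2)[OF that(1), of x] G(2)[OF that(2), of y] that by (auto simp: P_eq)
    then show ?thesis
      using G(1) by (intro gjoin_le[OF fp, of G])
  qed
  ultimately show ?thesis
    using that[of k X] k(1) X unfolding one_equiv_def by blast
qed

end

section \<open>Towers\<close>

locale tower = pairings P
  for P :: "nat \<Rightarrow> nat \<Rightarrow> nat \<Rightarrow> nat" +
  fixes Q :: "nat \<Rightarrow> nat \<Rightarrow> nat" and U :: "nat \<Rightarrow> nat set"
  assumes Q: "pairing Q"
    and tower: "weak_dyadic_tower P U"
    and not_cylinder: "\<not> is_cylinder Q (U 0)"
begin

text \<open>Expanding the fraction \<open>m / 2 ^ n\<close>: each level of the tower doubles the
  multiplicity.\<close>

lemma autojoin_shift:
  assumes "m \<ge> 1" shows "autojoin P m (U n) \<equiv>\<^sub>1 autojoin P (m * 2 ^ k) (U (n + k))"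
proof (induction k)
  case 0
  show ?case by (simp add: one_equiv_refl)
next
  case (Suc k)
  have m: "m * 2 ^ k \<ge> 1"
    using assms by simp
  have "autojoin P (m * 2 ^ k) (U (n + k)) \<equiv>\<^sub>1 autojoin P (m * 2 ^ k) (autojoin P 2 (U (n + Suc k)))"
    using tower by (intro autojoin_cong[OF m]) (simp add: weak_dyadic_tower_def)
  moreover have "autojoin P (m * 2 ^ k) (autojoin P 2 (U (n + Suc k))) \<equiv>\<^sub>1
      autojoin P (m * 2 ^ k * 2) (U (n + Suc k))"
    by (rule autojoin_mult[OF m]) simp
  moreover have "m * 2 ^ k * 2 = m * 2 ^ Suc k"
    by simp
  ultimately have "autojoin P (m * 2 ^ k) (U (n + k)) \<equiv>\<^sub>1 autojoin P (m * 2 ^ Suc k) (U (n + Suc k))"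
    using one_equiv_trans by simp
  with Suc show ?case
    by (rule one_equiv_trans)
qed

lemma autojoin_U0: "U 0 \<equiv>\<^sub>1 autojoin P (2 ^ n) (U n)"
  using autojoin_shift[of 1 0 n] one_equiv_trans[OF one_equiv_sym[OF autojoin_1]] by simp

text \<open>The path goes through \<open>autojoin P (2 ^ n) (U n)\<close>, whose block index is
  dropped. Together with the converse below, it places all autojoins of the tower in the bfo-degree
  of \<open>U 0\<close>.\<close>

lemma U0_bfo_red: "m \<ge> 1 \<Longrightarrow> U 0 \<le>\<^sub>b\<^sub>f\<^sub>o autojoin P m (U n)"
proof -
  assume m: "m \<ge> 1"
  have 1: "U 0 \<le>\<^sub>b\<^sub>f\<^sub>o autojoin P (2 ^ n) (U n)"
    using autojoin_U0 by (intro one_red_imp_bfo_red) (simp add: one_equiv_def)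
  have 2: "autojoin P (2 ^ n) (U n) \<le>\<^sub>b\<^sub>f\<^sub>o U n"
    by (rule autojoin_bfo_red) simp
  have "U n \<le>\<^sub>1 autojoin P m (U n)"
    using autojoin_1[of "U n"] autojoin_le[OF order_refl m, of "U n"] one_red_trans
    unfolding one_equiv_def by blast
  then show ?thesis
    using 1 2 one_red_imp_bfo_red bfo_red_trans by blast
qed

lemma bfo_red_U0: "m \<ge> 1 \<Longrightarrow> autojoin P m (U n) \<le>\<^sub>b\<^sub>f\<^sub>o U 0"
proof -
  assume m: "m \<ge> 1"
  have "U n \<le>\<^sub>1 autojoin P (2 ^ n) (U n)"
    using autojoin_1[of "U n"] autojoin_le[of 1 "2 ^ n" "U n"] one_red_trans
    unfolding one_equiv_def by (metis order_refl one_le_numeral one_le_power)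
  then have "U n \<le>\<^sub>1 U 0"
    using autojoin_U0[of n] one_red_trans unfolding one_equiv_def by blast
  then show ?thesis
    using autojoin_bfo_red[OF m] one_red_imp_bfo_red bfo_red_trans by blast
qed

lemma not_join_le:
  assumes "m \<ge> 1" "U 0 \<le>\<^sub>b\<^sub>f\<^sub>o D"
  shows "\<not> join P (autojoin P m (U n)) D \<le>\<^sub>1 autojoin P m (U n)"
  using is_cylinder_if_join_le[OF Q _ assms(2) bfo_red_U0[OF assms(1)]] not_cylinder by blast

lemma autojoin_le_same_iff:
  assumes "m \<ge> 1" "m' \<ge> 1"
  shows "autojoin P m (U n) \<le>\<^sub>1 autojoin P m' (U n) \<longleftrightarrow> m \<le> m'"
proof
  assume le: "autojoin P m (U n) \<le>\<^sub>1 autojoin P m' (U n)"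
  show "m \<le> m'"
  proof (rule ccontr)
    assume "\<not> m \<le> m'"
    \<comment> \<open>If \<open>m > m'\<close>, then \<open>m' + 1\<close> copies fit into
      \<open>m'\<close>, so \<open>m'\<close> copies would absorb one more.\<close>
    then have "autojoin P (m' + 1) (U n) \<le>\<^sub>1 autojoin P m (U n)"
      by (intro autojoin_le) auto
    then have "join P (autojoin P m' (U n)) (autojoin P 1 (U n)) \<le>\<^sub>1 autojoin P m' (U n)"
      using autojoin_add[OF assms(2) order_refl, of "U n"] le one_red_trans
      unfolding one_equiv_def by blast
    then show False
      using not_join_le[OF assms(2) U0_bfo_red[OF order_refl]] by blast
  qed
qed (rule autojoin_le[OF assms(1)])

lemma autojoin_le_iff:
  assumes "m \<ge> 1" "m' \<ge> 1"
  shows "autojoin P m (U n) \<le>\<^sub>1 autojoin P m' (U n') \<longleftrightarrow> m * 2 ^ n' \<le> m' * 2 ^ n"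
proof -
  have "autojoin P m (U n) \<equiv>\<^sub>1 autojoin P (m * 2 ^ n') (U (n + n'))"
    "autojoin P m' (U n') \<equiv>\<^sub>1 autojoin P (m' * 2 ^ n) (U (n + n'))"
    using autojoin_shift[OF assms(1), of n n'] autojoin_shift[OF assms(2), of n' n]
    by (simp_all add: add.commute)
  then have "autojoin P m (U n) \<le>\<^sub>1 autojoin P m' (U n') \<longleftrightarrow>
      autojoin P (m * 2 ^ n') (U (n + n')) \<le>\<^sub>1 autojoin P (m' * 2 ^ n) (U (n + n'))"
    unfolding one_equiv_def using one_red_trans by meson
  then show ?thesis
    using assms by (simp add: autojoin_le_same_iff)
qed

text \<open>Addition of dyadic fractions: both summands are moved to level \<open>n + n'\<close>,
  where multiplicities add.\<close>

lemma gjoin_autojoins: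
  assumes "k \<ge> 1" "\<And>i. i < k \<Longrightarrow> \<exists>m n. m \<ge> 1 \<and> A i \<equiv>\<^sub>1 autojoin P m (U n)"
  shows "\<exists>m n. m \<ge> 1 \<and> gjoin (P k) k A \<equiv>\<^sub>1 autojoin P m (U n)"
  using assms
proof (induction k rule: nat_induct_at_least)
  case base
  then show ?case
  proof -
    obtain m n where m: "m \<ge> 1" "A 0 \<equiv>\<^sub>1 autojoin P m (U n)"
      using base by auto
    show ?thesis
      using m(1) one_equiv_trans[OF gjoin_1[of A] m(2)] by blast
  qed
next
  case (Suc k)
  obtain m n where m: "m \<ge> 1" "gjoin (P k) k A \<equiv>\<^sub>1 autojoin P m (U n)"
    using Suc.IH Suc.prems less_SucI by blast
  obtain m' n' where m': "m' \<ge> 1" "A k \<equiv>\<^sub>1 autojoin P m' (U n')"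
    using Suc.prems by blast
  have m2: "m * 2 ^ n' \<ge> 1" "m' * 2 ^ n \<ge> 1"
    using m m' by auto
  have 1: "gjoin (P k) k A \<equiv>\<^sub>1 autojoin P (m * 2 ^ n') (U (n + n'))"
    using m(2) autojoin_shift[OF m(1)] by (rule one_equiv_trans)
  have "A k \<equiv>\<^sub>1 autojoin P (m' * 2 ^ n) (U (n' + n))"
    using m'(2) autojoin_shift[OF m'(1)] by (rule one_equiv_trans)
  then have 2: "gjoin (P 1) 1 (\<lambda>i. A (k + i)) \<equiv>\<^sub>1 autojoin P (m' * 2 ^ n) (U (n + n'))"
    using one_equiv_trans[OF gjoin_1[of "\<lambda>i. A (k + i)"]] by (simp add: add.commute)
  have "gjoin (P (k + 1)) (k + 1) A \<equiv>\<^sub>1 join P (gjoin (P k) k A) (gjoin (P 1) 1 (\<lambda>i. A (k + i)))"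
    using Suc.hyps by (intro gjoin_add) auto
  then have "gjoin (P (k + 1)) (k + 1) A \<equiv>\<^sub>1 autojoin P (m * 2 ^ n' + m' * 2 ^ n) (U (n + n'))"
    using join_cong[OF 1 2] one_equiv_sym[OF autojoin_add[OF m2]] one_equiv_trans by blast
  then show ?case
    using m2 by (metis Suc_eq_plus1 trans_le_add1)
qed

lemma bfo_equiv_imp_autojoin:
  assumes res: "has_computable_reservoirs (U 0)" and absorb: "base_absorption P (U 0) U"
    and B: "B \<equiv>\<^sub>b\<^sub>f\<^sub>o U 0"
  shows "\<exists>m n. m \<ge> 1 \<and> B \<equiv>\<^sub>1 autojoin P m (U n)"
proof -
  have BU: "B \<le>\<^sub>b\<^sub>f\<^sub>o U 0" and UB: "U 0 \<le>\<^sub>b\<^sub>f\<^sub>o B"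
    using B by (auto simp: bfo_equiv_def)
  obtain k X where k: "k \<ge> 1" and X: "\<And>i. X i \<le>\<^sub>1 U 0"
    and kX: "join P (autojoin P k (U 0)) B \<equiv>\<^sub>1 gjoin (P k) k (\<lambda>i. join P (U 0) (X i))"
    using gjoin_decomposition[OF BU join_empty_le[OF res]] by blast
  let ?C = "autojoin P k (U 0)"
  have "\<exists>m n. m \<ge> 1 \<and> join P (U 0) (X i) \<equiv>\<^sub>1 autojoin P m (U n)" for i
    using absorb X unfolding base_absorption_def by blast
  then obtain M N where M: "M \<ge> 1" "join P ?C B \<equiv>\<^sub>1 autojoin P M (U N)"
    using gjoin_autojoins[OF k, of "\<lambda>i. join P (U 0) (X i)"] kX one_equiv_trans by blast
  have C: "?C \<equiv>\<^sub>1 autojoin P (k * 2 ^ N) (U N)"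
    using autojoin_shift[OF k, of 0 N] by simp
  \<comment> \<open>Otherwise \<open>?C\<close> would absorb \<open>B\<close>, which lies bfo-above
    \<open>U 0\<close>, and \<open>U 0\<close> would be a cylinder.\<close>
  have "k * 2 ^ N < M"
  proof (rule ccontr)
    assume "\<not> k * 2 ^ N < M"
    then have "autojoin P M (U N) \<le>\<^sub>1 autojoin P (k * 2 ^ N) (U N)"
      using M(1) by (intro autojoin_le) auto
    then have "join P ?C B \<le>\<^sub>1 ?C"
      using M(2) C one_red_trans unfolding one_equiv_def by blast
    then show False
      using not_join_le[OF k UB] by blast
  qed
  then obtain w where w: "w \<ge> 1" "M = k * 2 ^ N + w"
    by (metis One_nat_def Suc_leI less_imp_add_positive)
  let ?W = "autojoin P w (U N)"
  have "autojoin P M (U N) \<equiv>\<^sub>1 join P (autojoin P (k * 2 ^ N) (U N)) ?W"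
    unfolding w(2) using k w(1) by (intro autojoin_add) auto
  moreover have "join P (autojoin P (k * 2 ^ N) (U N)) ?W \<equiv>\<^sub>1 join P ?C ?W"
    by (intro join_cong one_equiv_sym[OF C] one_equiv_refl)
  ultimately have "join P ?C B \<equiv>\<^sub>1 join P ?C ?W"
    using M(2) one_equiv_trans by blast
  \<comment> \<open>Cancellation is applied in both directions, so \<open>?C\<close> must be
    bfo-reducible to both right-hand summands.\<close>
  moreover have "?C \<le>\<^sub>b\<^sub>f\<^sub>o B" "?C \<le>\<^sub>b\<^sub>f\<^sub>o ?W"
    using bfo_red_trans[OF bfo_red_U0[OF k]] UB U0_bfo_red[OF w(1)] by blast+
  ultimately have "B \<equiv>\<^sub>1 ?W"
    unfolding one_equiv_def by (blast intro: join_cancel)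
  then show ?thesis
    using w(1) by blast
qed

end

theorem theorem4p6:
  fixes P :: "nat \<Rightarrow> nat \<Rightarrow> nat \<Rightarrow> nat" and Q :: "nat \<Rightarrow> nat \<Rightarrow> nat"
    and U :: "nat \<Rightarrow> nat set"
  assumes "\<And>m. m \<ge> 1 \<Longrightarrow> finite_pairing m (P m)"
    and "pairing Q"
    and "weak_dyadic_tower P U"
    and "\<not> is_cylinder Q (U 0)"
    and "has_computable_reservoirs (U 0)"
    and "base_absorption P (U 0) U"
  shows "(\<forall>B. B \<equiv>\<^sub>b\<^sub>f\<^sub>o U 0 \<longrightarrow> (\<exists>m n. m \<ge> 1 \<and> B \<equiv>\<^sub>1 autojoin P m (U n))) \<and>
         order_isomorphic {one_degree B | B. B \<equiv>\<^sub>b\<^sub>f\<^sub>o U 0} one_degree_le positive_dyadics (\<le>)"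
proof
  interpret tower P Q U
    using assms(1-4) by unfold_locales
  show all: "\<forall>B. B \<equiv>\<^sub>b\<^sub>f\<^sub>o U 0 \<longrightarrow> (\<exists>m n. m \<ge> 1 \<and> B \<equiv>\<^sub>1 autojoin P m (U n))"
    using bfo_equiv_imp_autojoin[OF assms(5,6)] by blast
  define deg where "deg m n = one_degree (autojoin P m (U n))" for m n
  define val :: "nat \<Rightarrow> nat \<Rightarrow> rat" where "val m n = of_nat m / 2 ^ n" for m n
  have val_le: "val m n \<le> val m' n' \<longleftrightarrow> m * 2 ^ n' \<le> m' * 2 ^ n" for m n m' n'
  proof -
    have "val m n \<le> val m' n' \<longleftrightarrow> (of_nat (m * 2 ^ n') :: rat) \<le> of_nat (m' * 2 ^ n)"
      by (simp add: val_def field_simps)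
    then show ?thesis
      by (simp only: of_nat_le_iff)
  qed
  have deg_le: "one_degree_le (deg m n) (deg m' n') \<longleftrightarrow> val m n \<le> val m' n'"
    if "m \<ge> 1" "m' \<ge> 1" for m n m' n'
    using that by (simp add: deg_def one_degree_le_iff autojoin_le_iff val_le)
  have deg_eq: "deg m n = deg m' n' \<longleftrightarrow> val m n = val m' n'" if "m \<ge> 1" "m' \<ge> 1" for m n m' n'
    using that deg_le by (auto simp: deg_def one_degree_eq_iff one_equiv_def one_degree_le_iff order_antisym_conv)
  let ?S = "{one_degree B | B. B \<equiv>\<^sub>b\<^sub>f\<^sub>o U 0}"
  have S: "?S = {deg m n | m n. m \<ge> 1}"
  proof
    show "?S \<subseteq> {deg m n | m n. m \<ge> 1}"
      using all one_degree_eq_iff unfolding deg_def by blast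
    show "{deg m n | m n. m \<ge> 1} \<subseteq> ?S"
      unfolding deg_def bfo_equiv_def using U0_bfo_red bfo_red_U0 by blast
  qed
  \<comment> \<open>A class has many presentations \<open>deg m n\<close>; \<open>deg_eq\<close>
    shows that they all have the same value.\<close>
  define phi where "phi D = (THE q. \<exists>m n. m \<ge> 1 \<and> D = deg m n \<and> q = val m n)" for D
  have phi: "phi (deg m n) = val m n" if "m \<ge> 1" for m n
    unfolding phi_def using that deg_eq by (intro the_equality) blast+
  have "bij_betw phi ?S positive_dyadics"
    unfolding bij_betw_def
  proof
    show "inj_on phi ?S"
    proof (rule inj_onI)
      fix D D' assume "D \<in> ?S" "D' \<in> ?S" and eq: "phi D = phi D'"
      then obtain m n m' n' where D: "m \<ge> 1" "D = deg m n" "m' \<ge> 1" "D' = deg m' n'"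
        unfolding S by blast
      then have "val m n = val m' n'"
        using eq phi by simp
      then show "D = D'"
        using D deg_eq by blast
    qed
    show "phi ` ?S = positive_dyadics"
    proof
      show "phi ` ?S \<subseteq> positive_dyadics"
      proof
        fix q assume "q \<in> phi ` ?S"
        then obtain m n where "m \<ge> 1" "q = val m n"
          unfolding S using phi by auto
        then show "q \<in> positive_dyadics"
          unfolding positive_dyadics_def val_def by blast
      qed
      show "positive_dyadics \<subseteq> phi ` ?S"
      proof
        fix q assume "q \<in> positive_dyadics"
        then obtain m n where mn: "m \<ge> 1" "q = val m n"
          unfolding positive_dyadics_def val_def by blast
        then have "deg m n \<in> ?S"
          unfolding S by blast
        moreover have "q = phi (deg m n)"
          using phi[OF mn(1)] mn(2) by simp
        ultimately show "q \<in> phi ` ?S"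
          by (rule rev_image_eqI)
      qed
    qed
  qed
  moreover have "\<forall>x\<in>?S. \<forall>y\<in>?S. one_degree_le x y \<longleftrightarrow> phi x \<le> phi y"
  proof (intro ballI)
    fix D D' assume "D \<in> ?S" "D' \<in> ?S"
    then obtain m n m' n' where D: "m \<ge> 1" "D = deg m n" "m' \<ge> 1" "D' = deg m' n'"
      unfolding S by blast
    then show "one_degree_le D D' \<longleftrightarrow> phi D \<le> phi D'"
      using phi deg_le by simp
  qed
  ultimately show "order_isomorphic ?S one_degree_le positive_dyadics (\<le>)"
    unfolding order_isomorphic_def by blast
qed

end
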